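(* Consider the intraday planning problem (ID) and the consensus ADMM iteration (x-update, z-update, y-update) described in the context, with fixed $\rho>0$. Suppose the standing numerical and economic conditions (i)--(v) listed in the context hold, that (ID) has a finite optimal value and its unaugmented Lagrangian has a saddle point, and that each local x-update is solved exactly and the consensus update is the stated z-update. Then the iterates satisfy $$r^k\to0,\qquad \sum_{i\in\mathcal N}f_i(x_i^k)\to J^\star,\qquad y^k\to y^\star,$$ where $J^\star$ is the optimal value of (ID) and $y^\star$ is a dual solution. Every accumulation point of the primal iterates is optimal for (ID). Moreover, under the correspondence between feasible points of (ID) and feasible points of the centralized physical problem described in the context, the limiting physical dispatch is also an optimum of the centralized problem.
   Context: **Network and index sets.** $(\mathcal N,\mathcal E)$ is a finite graph, $\mathcal N=\{1,\dots,N\}$ (control areas), $\mathcal E\subset\mathcal N\times\mathcal N$ (lines), each line stored once with a fixed orientation $e=(\mathrm{from}(e),\mathrm{to}(e))$; there are no self-loops and at most one line joins two areas. $\mathcal N_i$ is the set of neighbours of $i$, $K_i=|\mathcal N_i|$ (also the number of lines incident on $i$). For $e$ incident on $i$ (written $e\ni i$), $\sigma_{i,e}=+1$ if $i=\mathrm{from}(e)$ and $\sigma_{i,e}=-1$ if $i=\mathrm{to}(e)$. $\mathcal I,\mathcal B,\mathcal R\subseteq\mathcal N$ are the areas having, respectively, a converter plant, a battery, and renewable injection. $\mathcal G$ is a finite set of generating units with a placement map $\mathcal G\to\mathcal N$; $\mathcal G_i$ is the set of units placed at $i$. $H,M\ge1$ are integers, $\mathcal T=\{0,\dots,H-1\}$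 (stages), $\mathcal T_E=\{0,\dots,H\}$, $\mathcal M=\{1,\dots,M\}$ (scenarios), with probabilities $\pi_m>0$, $\sum_m\pi_m=1$. $\Delta_{\mathrm{ID}}=\tfrac14$ (hours). Variables of absent assets are omitted (and count as zero in sums); constraints and costs of absent assets are omitted. **Fixed data.** Real numbers: $P^{\mathrm{mot}}_i(t,m),P^{\mathrm{av}}_i(t,m),P^{\mathrm{res,max}}_i(t,m)\ge0$; unit envelopes $\overline P^{\mathrm g}_g(t,m),\overline P^{\mathrm p}_g(t,m)$; all scenario data at $t=0$ do not depend on $m$. Lines: $B_e>0$, $\bar P_e>0$, and loss-cut coefficients $a_{e,\kappa},b_{e,\kappa}\in\mathbb R$, $\kappa=1,\dots,K_\ell$. Batteries: $\underline E_i,\overline E_i,\overline P^{\mathrm b}_i,E^0_i,E^{\mathrm{term}}_i$, $\eta^{\mathrm c}_i,\eta^{\mathrm d}_i\in(0,1]$, references $E^{\mathrm{ref}}_i(t+1)$. Converters: $\underline P^{\mathrm{cv}}_i,\overline P^{\mathrm{cv}}_i,\Delta\overline P^{\mathrm{cv}}_i,p^{\mathrm{conv,prev}}_{i,n}$, peak targets $\bar p^{\mathrm{DA}}_i$, frozen commitments $\delta^{\mathrm{DA}}_i(h)\in\{0,1\}$ for day-ahead hours $h$ in a finite set $\mathcal H^{\mathrm{DA}}$, a map $h_n:\mathcal T\to\mathcal H^{\mathrm{DA}}$ giving the hour containing stage $t$, cleared energies $e^{\mathrm{DA}}_i(h)$ and already delivered energies $e^{\mathrm{past}}_{i,h}(n)$;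 $G_{n,h}=\{t\in\mathcal T:h_n(t)=h\}$. Costs: $c^{\mathrm g}_g(t),c^{\mathrm p}_g(t),a_g(t),c^{\mathrm b}_i,c^{\mathrm{ct}}_i,c^{\mathrm{rg}}_i,c^{\mathrm{pk}},w^{\mathrm{soc}}_i,\varepsilon_i\ge0$, $c^{\mathrm{ls}}>0$, and signed prices $c^E_i(t),c^{E,\mathrm x}_i(t)\in\mathbb R$. **Variables of area $i$**, collected in $x_i\in\mathbb R^{n_i}$ ($n_i$ = number of scalar coordinates), for all $(t,m)\in\mathcal T\times\mathcal M$ unless indicated: $p^{\mathrm{conv}}_i,q_i^+,q_i^-$ and $s^{\mathrm{pk}}_i(m)$ (if $i\in\mathcal I$; $s_i^{\mathrm{pk}}$ has one entry per scenario); $p^{\mathrm c}_i,p^{\mathrm d}_i$ and $E_i(s,m)$, $s\in\mathcal T_E$ (if $i\in\mathcal B$); $p^{\mathrm{res}}_i$ (if $i\in\mathcal R$); $p^{\mathrm g}_g,p^{\mathrm{pump}}_g$ for $g\in\mathcal G_i$; $p^{\mathrm{reg}}_i$; own angle $\theta_{i,i}$; flow copies $p^{\mathrm{flow}}_{e,i}$ for $e\ni i$; neighbour-angle copies $\theta_{j,i}$ for $j\in\mathcal N_i$; $\ell_e$ for lines with $\mathrm{from}(e)=i$. **Local feasible set $\mathcal X_i$**: all $x_i$ satisfying, for all applicable indices, (1) $0\le p^{\mathrm{reg}}_i\le P^{\mathrm{av}}_i$; (2) $p^{\mathrm{conv}}_i+\sum_{g\in\mathcal G_i}(p^{\mathrm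 g}_g-p^{\mathrm{pump}}_g)+p^{\mathrm d}_i-p^{\mathrm c}_i+p^{\mathrm{res}}_i+p^{\mathrm{reg}}_i-\sum_{e\ni i}\sigma_{i,e}p^{\mathrm{flow}}_{e,i}=P^{\mathrm{mot}}_i$; (3) $p^{\mathrm{flow}}_{e,i}=\sigma_{i,e}B_e(\theta_{i,i}-\theta_{j,i})$ for $e$ joining $i$ and $j$, and $|p^{\mathrm{flow}}_{e,i}|\le\bar P_e$; (4) $\ell_e\ge a_{e,\kappa}p^{\mathrm{flow}}_{e,i}+b_{e,\kappa}$ for $i=\mathrm{from}(e)$, $\kappa=1,\dots,K_\ell$; (5) $E_i(0,m)=E_i^0$, $E_i(t+1,m)=E_i(t,m)+\Delta_{\mathrm{ID}}(\eta^{\mathrm c}_ip^{\mathrm c}_i-p^{\mathrm d}_i/\eta^{\mathrm d}_i)$, $\underline E_i\le E_i(s,m)\le\overline E_i$ ($s\in\mathcal T_E$), $0\le p^{\mathrm c}_i,p^{\mathrm d}_i\le\overline P^{\mathrm b}_i$, $E_i(H,m)\ge E^{\mathrm{term}}_i$; (6) $p^{\mathrm{conv}}_i=q_i^+-q_i^-$, $q_i^\pm\ge0$, $\delta^{\mathrm{DA}}_i(h_n(t))\underline P^{\mathrm{cv}}_i\le p^{\mathrm{conv}}_i(t,m)\le\delta^{\mathrm{DA}}_i(h_n(t))\overline P^{\mathrm{cv}}_i$, $|p^{\mathrm{conv}}_i(0,m)-p^{\mathrm{conv,prev}}_{i,n}|\le\Delta\overline P^{\mathrm{cv}}_i$, $|p^{\mathrm{conv}}_i(t,m)-p^{\mathrm{conv}}_i(t-1,m)|\le\Delta\overline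 P^{\mathrm{cv}}_i$ ($t\ge1$); (7) $0\le p^{\mathrm g}_g\le\overline P^{\mathrm g}_g$, $0\le p^{\mathrm{pump}}_g\le\overline P^{\mathrm p}_g$; (8) $0\le p^{\mathrm{res}}_i\le P^{\mathrm{res,max}}_i$; (9) $s^{\mathrm{pk}}_i(m)\ge q_i^+(t,m)-\bar p^{\mathrm{DA}}_i$ for all $t$, $s^{\mathrm{pk}}_i(m)\ge0$; (10) $\Delta_{\mathrm{ID}}\sum_{t\in G_{n,h}}p^{\mathrm{conv}}_i(t,m)=e^{\mathrm{DA}}_i(h)-e^{\mathrm{past}}_{i,h}(n)$ for every $m$ and every gate-closed hour $h$ (from a given set of hours) with $G_{n,h}\neq\emptyset$ whose remaining quarter-hours all lie in the horizon; (11) $u_i(0,m)=u_i(0,m')$ for all $m,m'$, where $u_i(t,m)=\operatorname{col}(p^{\mathrm{conv}}_i,p^{\mathrm c}_i,p^{\mathrm d}_i,p^{\mathrm{res}}_i,p^{\mathrm{reg}}_i,(p^{\mathrm g}_g,p^{\mathrm{pump}}_g)_{g\in\mathcal G_i})(t,m)$. **Objective.** With $\ell_i(t,m)=\Delta_{\mathrm{ID}}(c^E_iq_i^+-c^{E,\mathrm x}_iq_i^-)+\Delta_{\mathrm{ID}}c^{\mathrm b}_i(p^{\mathrm c}_i+p^{\mathrm d}_i)+\Delta_{\mathrm{ID}}c^{\mathrm{ct}}_i(P^{\mathrm{res,max}}_i-p^{\mathrm{res}}_i)+c^{\mathrm{pk}}s^{\mathrm{pk}}_i(m)+\Delta_{\mathrm{ID}}c^{\mathrm{rg}}_i(P^{\mathrm{av}}_i-p^{\mathrm{reg}}_i)+\Delta_{\mathrm{ID}}\sum_{g\in\mathcal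 G_i}[c^{\mathrm g}_gp^{\mathrm g}_g+c^{\mathrm p}_gp^{\mathrm{pump}}_g+\tfrac{a_g}{2}(p^{\mathrm g}_g-p^{\mathrm{pump}}_g)^2]$ (arguments $t$ or $(t,m)$ suppressed), set $$f_i(x_i)=\sum_m\pi_m\sum_{t\in\mathcal T}\Big(\ell_i(t,m)+\sum_{e:\,i=\mathrm{from}(e)}c^{\mathrm{ls}}\ell_e(t,m)\Delta_{\mathrm{ID}}\Big)+\frac{w^{\mathrm{soc}}_i}{2}\sum_m\pi_m\sum_{t\in\mathcal T}(E_i(t+1,m)-E^{\mathrm{ref}}_i(t+1))^2+\frac{\varepsilon_i}{2}\|x_i\|^2 .$$ **Problem (ID).** For $a\in\{i\}\cup\mathcal N_i$ let $S_i^{(a)}\in\{0,1\}^{HM\times n_i}$ select the block $\theta_{a,i}\in\mathbb R^{HM}$ of $x_i$. Fix a reference area $r$. (ID) is: minimize $\sum_{i\in\mathcal N}f_i(x_i)$ over $\{x_i\}$ and $z_a\in\mathbb R^{HM}$ ($a\in\mathcal N$) subject to $x_i\in\mathcal X_i$, $S_i^{(a)}x_i=z_a$ for all $i\in\mathcal N$, $a\in\{i\}\cup\mathcal N_i$, and $z_r=0$. **Standing conditions.** (i) The graph is finite and connected, $H,M,K_\ell$ are positive integers, $B_e,\bar P_e\in(0,\infty)$. (ii) $0\le\underline E_i\le\overline E_i<\infty$, $\overline P^{\mathrm b}_i\in[0,\infty)$, $\eta^{\mathrm c}_i,\eta^{\mathrm d}_i\in(0,1]$, $E_i^0,E_i^{\mathrm{term}}\in\mathbb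 R$ for $i\in\mathcal B$; $-\infty<\underline P^{\mathrm{cv}}_i\le0\le\overline P^{\mathrm{cv}}_i<\infty$, $\Delta\overline P^{\mathrm{cv}}_i\in[0,\infty)$, $p^{\mathrm{conv,prev}}_{i,n}\in\mathbb R$ for $i\in\mathcal I$. (iii) $P^{\mathrm{mot}}_i,P^{\mathrm{av}}_i,P^{\mathrm{res,max}}_i,\overline P^{\mathrm g}_g,\overline P^{\mathrm p}_g$ take values in $[0,\infty)$. (iv) $\delta^{\mathrm{DA}}_i(h)\in\{0,1\}$, $\bar p^{\mathrm{DA}}_i\in[0,\infty)$, all other day-ahead quantities, $e^{\mathrm{past}}_{i,h}(n)$, $E^{\mathrm{ref}}_i(t+1)$, $a_{e,\kappa},b_{e,\kappa}$ are real, and $h_n(t)\in\mathcal H^{\mathrm{DA}}$. (v) $\pi_m\in(0,1]$, $\sum_m\pi_m=1$; $c^{\mathrm g}_g,c^{\mathrm p}_g,a_g,c^{\mathrm b}_i,c^{\mathrm{ct}}_i,c^{\mathrm{rg}}_i,w^{\mathrm{soc}}_i,c^{\mathrm{pk}},\varepsilon_i\in[0,\infty)$, $c^{\mathrm{ls}}\in(0,\infty)$, $c^E_i(t),c^{E,\mathrm x}_i(t)\in\mathbb R$ with $c^E_i(t)>c^{E,\mathrm x}_i(t)$ for $i\in\mathcal I,t\in\mathcal T$. All data are fixed. **ADMM.** Multipliers $y_i^{(a)}\in\mathbb R^{HM}$ are attached to $S_i^{(a)}x_i=z_a$ ($i\in\mathcal N$, $a\in\{i\}\cup\mathcal N_i$).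 The (unaugmented) Lagrangian of (ID) is $\sum_i[f_i(x_i)+\sum_{a\in\{i\}\cup\mathcal N_i}y_i^{(a)\top}(S_i^{(a)}x_i-z_a)]$ over $x_i\in\mathcal X_i$, $z_r=0$. Given $z^k,y^k$, the iteration is: x-update: $x_i^{k+1}\in\arg\min_{x_i\in\mathcal X_i}f_i(x_i)+\sum_{a\in\{i\}\cup\mathcal N_i}[y_i^{(a),k\top}(S_i^{(a)}x_i-z_a^k)+\tfrac\rho2\|S_i^{(a)}x_i-z_a^k\|^2]$ for every $i$; z-update: with $\mathcal H_a=\{a\}\cup\mathcal N_a$ and $d_a=1+K_a$, $z_a^{k+1}=\frac1{d_a}\sum_{i\in\mathcal H_a}(S_i^{(a)}x_i^{k+1}+\tfrac1\rho y_i^{(a),k})$ for $a\ne r$ and $z_r^{k+1}=0$; y-update: $y_i^{(a),k+1}=y_i^{(a),k}+\rho(S_i^{(a)}x_i^{k+1}-z_a^{k+1})$. The primal residual is $r^k=\operatorname{col}_{i,a}(S_i^{(a)}x_i^k-z_a^k)$; $y^k=\operatorname{col}_{i,a}y_i^{(a),k}$. **Centralized physical problem.** It uses one angle $\theta_a(t,m)$ per area, with $\theta_r=0$, one flow $p_e(t,m)=B_e(\theta_{\mathrm{from}(e)}-\theta_{\mathrm{to}(e)})$ per line, and the same area-local asset variables and loss variables $\ell_e$; constraints and objective are those of (ID) with every copy $\theta_{a,i}$ replaced by $\theta_a$ and every copy $p^{\mathrm{flow}}_{e,i}$ by $p_e$ (each line cost assigned once). A feasible point of (ID) corresponds to the centralized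 point with $\theta_a=z_a$, $p_e$ the common value of the two flow copies, and the same asset variables. *)

theory Defs
  imports "HOL-Analysis.Analysis"
begin

section \<open>Data\<close>

text \<open>
  Areas are \<open>1, ..., n_areas\<close>, scenarios \<open>1, ..., n_scen\<close>, stages \<open>0, ..., horizon - 1\<close>.
  A line is the ordered pair of its from-area and its to-area.
  Arguments are ordered (area or unit or line), stage, scenario.
  The field \<open>remaining h\<close> lists the not yet elapsed quarter-hours of the day-ahead hour \<open>h\<close>, counted
  as stages from the current quarter-hour; some of them may lie beyond the planning horizon.
\<close>

record ('g, 'h) id_data =
  n_areas     :: nat
  line_set    :: "(nat \<times> nat) set"
  conv_areas  :: "nat set"
  batt_areas  :: "nat set"
  res_areas   :: "nat set"
  ref_area    :: nat
  gen_units   :: "'g set"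
  unit_area   :: "'g \<Rightarrow> nat"
  horizon     :: nat
  n_scen      :: nat
  scen_prob   :: "nat \<Rightarrow> real"
  P_mot       :: "nat \<Rightarrow> nat \<Rightarrow> nat \<Rightarrow> real"
  P_av        :: "nat \<Rightarrow> nat \<Rightarrow> nat \<Rightarrow> real"
  P_res_max   :: "nat \<Rightarrow> nat \<Rightarrow> nat \<Rightarrow> real"
  P_gen_max   :: "'g \<Rightarrow> nat \<Rightarrow> nat \<Rightarrow> real"
  P_pump_max  :: "'g \<Rightarrow> nat \<Rightarrow> nat \<Rightarrow> real"
  suscept     :: "nat \<times> nat \<Rightarrow> real"
  flow_max    :: "nat \<times> nat \<Rightarrow> real"
  n_cuts      :: nat
  cut_slope   :: "nat \<times> nat \<Rightarrow> nat \<Rightarrow> real"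
  cut_icpt    :: "nat \<times> nat \<Rightarrow> nat \<Rightarrow> real"
  E_min       :: "nat \<Rightarrow> real"
  E_max       :: "nat \<Rightarrow> real"
  P_batt_max  :: "nat \<Rightarrow> real"
  E_init      :: "nat \<Rightarrow> real"
  E_term      :: "nat \<Rightarrow> real"
  eff_c       :: "nat \<Rightarrow> real"
  eff_d       :: "nat \<Rightarrow> real"
  E_ref       :: "nat \<Rightarrow> nat \<Rightarrow> real"
  P_cv_min    :: "nat \<Rightarrow> real"
  P_cv_max    :: "nat \<Rightarrow> real"
  cv_ramp     :: "nat \<Rightarrow> real"
  conv_prev   :: "nat \<Rightarrow> real"
  peak_da     :: "nat \<Rightarrow> real"
  da_hours    :: "'h set"
  hour_of     :: "nat \<Rightarrow> 'h"
  gate_closed :: "'h set"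
  remaining   :: "'h \<Rightarrow> nat set"
  commit_da   :: "nat \<Rightarrow> 'h \<Rightarrow> real"
  e_da        :: "nat \<Rightarrow> 'h \<Rightarrow> real"
  e_past      :: "nat \<Rightarrow> 'h \<Rightarrow> real"
  c_gen       :: "'g \<Rightarrow> nat \<Rightarrow> real"
  c_pump      :: "'g \<Rightarrow> nat \<Rightarrow> real"
  a_quad      :: "'g \<Rightarrow> nat \<Rightarrow> real"
  c_batt      :: "nat \<Rightarrow> real"
  c_curt      :: "nat \<Rightarrow> real"
  c_reg       :: "nat \<Rightarrow> real"
  c_peak      :: real
  w_soc       :: "nat \<Rightarrow> real"
  eps_reg     :: "nat \<Rightarrow> real"
  c_loss      :: real
  c_buy       :: "nat \<Rightarrow> nat \<Rightarrow> real"
  c_sell      :: "nat \<Rightarrow> nat \<Rightarrow> real"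

definition Delta_ID :: real where "Delta_ID = 1 / 4"

definition areas :: "('g, 'h) id_data \<Rightarrow> nat set" where
  "areas D = {1..n_areas D}"

definition stages :: "('g, 'h) id_data \<Rightarrow> nat set" where
  "stages D = {0..<horizon D}"

definition scens :: "('g, 'h) id_data \<Rightarrow> nat set" where
  "scens D = {1..n_scen D}"

definition slots :: "('g, 'h) id_data \<Rightarrow> (nat \<times> nat) set" where
  "slots D = stages D \<times> scens D"

definition nbrs :: "('g, 'h) id_data \<Rightarrow> nat \<Rightarrow> nat set" where
  "nbrs D i = {j. (i, j) \<in> line_set D \<or> (j, i) \<in> line_set D}"

definition hood :: "('g, 'h) id_data \<Rightarrow> nat \<Rightarrow> nat set" where
  "hood D i = {i} \<union> nbrs D i"

definition incident :: "('g, 'h) id_data \<Rightarrow> nat \<Rightarrow> (nat \<times> nat) set" where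
  "incident D i = {e \<in> line_set D. fst e = i \<or> snd e = i}"

definition orient :: "nat \<Rightarrow> nat \<times> nat \<Rightarrow> real" where
  "orient i e = (if i = fst e then 1 else - 1)"

definition other_end :: "nat \<Rightarrow> nat \<times> nat \<Rightarrow> nat" where
  "other_end i e = (if i = fst e then snd e else fst e)"

definition units_at :: "('g, 'h) id_data \<Rightarrow> nat \<Rightarrow> 'g set" where
  "units_at D i = {g \<in> gen_units D. unit_area D g = i}"

definition hour_stages :: "('g, 'h) id_data \<Rightarrow> 'h \<Rightarrow> nat set" where
  "hour_stages D h = {t \<in> stages D. hour_of D t = h}"

definition id_model :: "('g, 'h) id_data \<Rightarrow> bool" where
  "id_model D \<longleftrightarrow>
     line_set D \<subseteq> areas D \<times> areas D \<and>
     (\<forall>i j. (i, j) \<in> line_set D \<longrightarrow> i \<noteq> j \<and> (j, i) \<notin> line_set D) \<and>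
     conv_areas D \<subseteq> areas D \<and> batt_areas D \<subseteq> areas D \<and> res_areas D \<subseteq> areas D \<and>
     ref_area D \<in> areas D \<and>
     finite (gen_units D) \<and> unit_area D ` gen_units D \<subseteq> areas D \<and>
     (\<forall>i\<in>areas D. \<forall>m\<in>scens D. \<forall>m'\<in>scens D.
        P_mot D i 0 m = P_mot D i 0 m' \<and> P_av D i 0 m = P_av D i 0 m') \<and>
     (\<forall>i\<in>res_areas D. \<forall>m\<in>scens D. \<forall>m'\<in>scens D. P_res_max D i 0 m = P_res_max D i 0 m') \<and>
     (\<forall>g\<in>gen_units D. \<forall>m\<in>scens D. \<forall>m'\<in>scens D.
        P_gen_max D g 0 m = P_gen_max D g 0 m' \<and> P_pump_max D g 0 m = P_pump_max D g 0 m') \<and>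
     finite (da_hours D) \<and> gate_closed D \<subseteq> da_hours D \<and>
     (\<forall>h\<in>da_hours D. remaining D h \<inter> stages D = hour_stages D h)"

definition standing_conditions :: "('g, 'h) id_data \<Rightarrow> bool" where
  "standing_conditions D \<longleftrightarrow>
     (\<forall>i\<in>areas D. \<forall>j\<in>areas D. (i, j) \<in> (line_set D \<union> (line_set D)\<inverse>)\<^sup>*) \<and>
     horizon D > 0 \<and> n_scen D > 0 \<and> n_cuts D > 0 \<and>
     (\<forall>e\<in>line_set D. suscept D e > 0 \<and> flow_max D e > 0) \<and>
     (\<forall>i\<in>batt_areas D. 0 \<le> E_min D i \<and> E_min D i \<le> E_max D i \<and> 0 \<le> P_batt_max D i \<and>
        0 < eff_c D i \<and> eff_c D i \<le> 1 \<and> 0 < eff_d D i \<and> eff_d D i \<le> 1) \<and>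
     (\<forall>i\<in>conv_areas D. P_cv_min D i \<le> 0 \<and> 0 \<le> P_cv_max D i \<and> 0 \<le> cv_ramp D i) \<and>
     (\<forall>t\<in>stages D. \<forall>m\<in>scens D.
        (\<forall>i\<in>areas D. 0 \<le> P_mot D i t m \<and> 0 \<le> P_av D i t m) \<and>
        (\<forall>i\<in>res_areas D. 0 \<le> P_res_max D i t m) \<and>
        (\<forall>g\<in>gen_units D. 0 \<le> P_gen_max D g t m \<and> 0 \<le> P_pump_max D g t m)) \<and>
     (\<forall>i\<in>conv_areas D. 0 \<le> peak_da D i \<and> (\<forall>h\<in>da_hours D. commit_da D i h \<in> {0, 1})) \<and>
     (\<forall>t\<in>stages D. hour_of D t \<in> da_hours D) \<and>
     (\<forall>m\<in>scens D. 0 < scen_prob D m \<and> scen_prob D m \<le> 1) \<and> (\<Sum>m\<in>scens D. scen_prob D m) = 1 \<and>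
     (\<forall>g\<in>gen_units D. \<forall>t\<in>stages D. 0 \<le> c_gen D g t \<and> 0 \<le> c_pump D g t \<and> 0 \<le> a_quad D g t) \<and>
     (\<forall>i\<in>batt_areas D. 0 \<le> c_batt D i \<and> 0 \<le> w_soc D i) \<and>
     (\<forall>i\<in>res_areas D. 0 \<le> c_curt D i) \<and>
     (\<forall>i\<in>areas D. 0 \<le> c_reg D i \<and> 0 \<le> eps_reg D i) \<and>
     0 \<le> c_peak D \<and> 0 < c_loss D \<and>
     (\<forall>i\<in>conv_areas D. \<forall>t\<in>stages D. c_sell D i t < c_buy D i t)"


section \<open>Variables of an area\<close>

text \<open>
  The coordinates of \<open>x\<^sub>i\<close> are named by the following type; \<open>Angle a t m\<close> in \<open>x\<^sub>i\<close> is \<open>\<theta>\<^sub>a\<^sub>,\<^sub>i(t,m)\<close> (the own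
  angle if \<open>a = i\<close>), and \<open>Flow e t m\<close> in \<open>x\<^sub>i\<close> is the flow copy of line \<open>e\<close> held by \<open>i\<close>.
  A vector of the coordinate space of area \<open>i\<close> is a function on all names that vanishes off
  \<open>coords D i\<close>; hence an omitted variable contributes zero to every sum.
\<close>

datatype 'g coord =
    PConv nat nat | QPlus nat nat | QMinus nat nat | SPeak nat
  | PCh nat nat | PDis nat nat | Soc nat nat
  | PRes nat nat
  | PGen 'g nat nat | PPump 'g nat nat
  | PReg nat nat
  | Angle nat nat nat
  | Flow "nat \<times> nat" nat nat
  | Loss "nat \<times> nat" nat nat

fun has_coord :: "('g, 'h) id_data \<Rightarrow> nat \<Rightarrow> 'g coord \<Rightarrow> bool" where
  "has_coord D i (PConv t m) \<longleftrightarrow> i \<in> conv_areas D \<and> t \<in> stages D \<and> m \<in> scens D"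
| "has_coord D i (QPlus t m) \<longleftrightarrow> i \<in> conv_areas D \<and> t \<in> stages D \<and> m \<in> scens D"
| "has_coord D i (QMinus t m) \<longleftrightarrow> i \<in> conv_areas D \<and> t \<in> stages D \<and> m \<in> scens D"
| "has_coord D i (SPeak m) \<longleftrightarrow> i \<in> conv_areas D \<and> m \<in> scens D"
| "has_coord D i (PCh t m) \<longleftrightarrow> i \<in> batt_areas D \<and> t \<in> stages D \<and> m \<in> scens D"
| "has_coord D i (PDis t m) \<longleftrightarrow> i \<in> batt_areas D \<and> t \<in> stages D \<and> m \<in> scens D"
| "has_coord D i (Soc s m) \<longleftrightarrow> i \<in> batt_areas D \<and> s \<in> {0..horizon D} \<and> m \<in> scens D"
| "has_coord D i (PRes t m) \<longleftrightarrow> i \<in> res_areas D \<and> t \<in> stages D \<and> m \<in> scens D"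
| "has_coord D i (PGen g t m) \<longleftrightarrow> g \<in> units_at D i \<and> t \<in> stages D \<and> m \<in> scens D"
| "has_coord D i (PPump g t m) \<longleftrightarrow> g \<in> units_at D i \<and> t \<in> stages D \<and> m \<in> scens D"
| "has_coord D i (PReg t m) \<longleftrightarrow> t \<in> stages D \<and> m \<in> scens D"
| "has_coord D i (Angle a t m) \<longleftrightarrow> a \<in> hood D i \<and> t \<in> stages D \<and> m \<in> scens D"
| "has_coord D i (Flow e t m) \<longleftrightarrow> e \<in> incident D i \<and> t \<in> stages D \<and> m \<in> scens D"
| "has_coord D i (Loss e t m) \<longleftrightarrow> e \<in> line_set D \<and> fst e = i \<and> t \<in> stages D \<and> m \<in> scens D"

definition coords :: "('g, 'h) id_data \<Rightarrow> nat \<Rightarrow> 'g coord set" where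
  "coords D i = {c. has_coord D i c}"

definition area_space :: "('g, 'h) id_data \<Rightarrow> nat \<Rightarrow> ('g coord \<Rightarrow> real) set" where
  "area_space D i = {v. \<forall>c. c \<notin> coords D i \<longrightarrow> v c = 0}"


section \<open>Local feasible sets\<close>

definition reg_con :: "('g, 'h) id_data \<Rightarrow> nat \<Rightarrow> ('g coord \<Rightarrow> real) \<Rightarrow> bool" where
  "reg_con D i v \<longleftrightarrow> (\<forall>t\<in>stages D. \<forall>m\<in>scens D. 0 \<le> v (PReg t m) \<and> v (PReg t m) \<le> P_av D i t m)"

definition balance_con :: "('g, 'h) id_data \<Rightarrow> nat \<Rightarrow> ('g coord \<Rightarrow> real) \<Rightarrow> bool" where
  "balance_con D i v \<longleftrightarrow> (\<forall>t\<in>stages D. \<forall>m\<in>scens D.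
     v (PConv t m) + (\<Sum>g\<in>units_at D i. v (PGen g t m) - v (PPump g t m))
     + v (PDis t m) - v (PCh t m) + v (PRes t m) + v (PReg t m)
     - (\<Sum>e\<in>incident D i. orient i e * v (Flow e t m)) = P_mot D i t m)"

definition flow_con :: "('g, 'h) id_data \<Rightarrow> nat \<Rightarrow> ('g coord \<Rightarrow> real) \<Rightarrow> bool" where
  "flow_con D i v \<longleftrightarrow> (\<forall>e\<in>incident D i. \<forall>t\<in>stages D. \<forall>m\<in>scens D.
     v (Flow e t m) = orient i e * suscept D e * (v (Angle i t m) - v (Angle (other_end i e) t m)) \<and>
     \<bar>v (Flow e t m)\<bar> \<le> flow_max D e)"

definition loss_con :: "('g, 'h) id_data \<Rightarrow> nat \<Rightarrow> ('g coord \<Rightarrow> real) \<Rightarrow> bool" where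
  "loss_con D i v \<longleftrightarrow> (\<forall>e\<in>line_set D. fst e = i \<longrightarrow>
     (\<forall>t\<in>stages D. \<forall>m\<in>scens D. \<forall>\<kappa>\<in>{1..n_cuts D}.
        v (Loss e t m) \<ge> cut_slope D e \<kappa> * v (Flow e t m) + cut_icpt D e \<kappa>))"

definition battery_con :: "('g, 'h) id_data \<Rightarrow> nat \<Rightarrow> ('g coord \<Rightarrow> real) \<Rightarrow> bool" where
  "battery_con D i v \<longleftrightarrow> (\<forall>m\<in>scens D.
     v (Soc 0 m) = E_init D i \<and>
     (\<forall>t\<in>stages D. v (Soc (t + 1) m) =
        v (Soc t m) + Delta_ID * (eff_c D i * v (PCh t m) - v (PDis t m) / eff_d D i)) \<and>
     (\<forall>s\<in>{0..horizon D}. E_min D i \<le> v (Soc s m) \<and> v (Soc s m) \<le> E_max D i) \<and>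
     (\<forall>t\<in>stages D. 0 \<le> v (PCh t m) \<and> v (PCh t m) \<le> P_batt_max D i \<and>
                    0 \<le> v (PDis t m) \<and> v (PDis t m) \<le> P_batt_max D i) \<and>
     v (Soc (horizon D) m) \<ge> E_term D i)"

definition converter_con :: "('g, 'h) id_data \<Rightarrow> nat \<Rightarrow> ('g coord \<Rightarrow> real) \<Rightarrow> bool" where
  "converter_con D i v \<longleftrightarrow> (\<forall>m\<in>scens D.
     (\<forall>t\<in>stages D.
        v (PConv t m) = v (QPlus t m) - v (QMinus t m) \<and>
        0 \<le> v (QPlus t m) \<and> 0 \<le> v (QMinus t m) \<and>
        commit_da D i (hour_of D t) * P_cv_min D i \<le> v (PConv t m) \<and>
        v (PConv t m) \<le> commit_da D i (hour_of D t) * P_cv_max D i) \<and>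
     \<bar>v (PConv 0 m) - conv_prev D i\<bar> \<le> cv_ramp D i \<and>
     (\<forall>t\<in>stages D. t \<ge> 1 \<longrightarrow> \<bar>v (PConv t m) - v (PConv (t - 1) m)\<bar> \<le> cv_ramp D i))"

definition unit_con :: "('g, 'h) id_data \<Rightarrow> nat \<Rightarrow> ('g coord \<Rightarrow> real) \<Rightarrow> bool" where
  "unit_con D i v \<longleftrightarrow> (\<forall>g\<in>units_at D i. \<forall>t\<in>stages D. \<forall>m\<in>scens D.
     0 \<le> v (PGen g t m) \<and> v (PGen g t m) \<le> P_gen_max D g t m \<and>
     0 \<le> v (PPump g t m) \<and> v (PPump g t m) \<le> P_pump_max D g t m)"

definition res_con :: "('g, 'h) id_data \<Rightarrow> nat \<Rightarrow> ('g coord \<Rightarrow> real) \<Rightarrow> bool" where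
  "res_con D i v \<longleftrightarrow> (\<forall>t\<in>stages D. \<forall>m\<in>scens D.
     0 \<le> v (PRes t m) \<and> v (PRes t m) \<le> P_res_max D i t m)"

definition peak_con :: "('g, 'h) id_data \<Rightarrow> nat \<Rightarrow> ('g coord \<Rightarrow> real) \<Rightarrow> bool" where
  "peak_con D i v \<longleftrightarrow> (\<forall>m\<in>scens D.
     0 \<le> v (SPeak m) \<and> (\<forall>t\<in>stages D. v (SPeak m) \<ge> v (QPlus t m) - peak_da D i))"

definition delivery_con :: "('g, 'h) id_data \<Rightarrow> nat \<Rightarrow> ('g coord \<Rightarrow> real) \<Rightarrow> bool" where
  "delivery_con D i v \<longleftrightarrow> (\<forall>m\<in>scens D. \<forall>h\<in>gate_closed D.
     hour_stages D h \<noteq> {} \<and> remaining D h \<subseteq> stages D \<longrightarrow>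
     Delta_ID * (\<Sum>t\<in>hour_stages D h. v (PConv t m)) = e_da D i h - e_past D i h)"

definition nonanticip_con :: "('g, 'h) id_data \<Rightarrow> nat \<Rightarrow> ('g coord \<Rightarrow> real) \<Rightarrow> bool" where
  "nonanticip_con D i v \<longleftrightarrow> (\<forall>m\<in>scens D. \<forall>m'\<in>scens D.
     v (PConv 0 m) = v (PConv 0 m') \<and> v (PCh 0 m) = v (PCh 0 m') \<and>
     v (PDis 0 m) = v (PDis 0 m') \<and> v (PRes 0 m) = v (PRes 0 m') \<and>
     v (PReg 0 m) = v (PReg 0 m') \<and>
     (\<forall>g\<in>units_at D i. v (PGen g 0 m) = v (PGen g 0 m') \<and> v (PPump g 0 m) = v (PPump g 0 m')))"

definition local_set :: "('g, 'h) id_data \<Rightarrow> nat \<Rightarrow> ('g coord \<Rightarrow> real) set" where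
  "local_set D i = {v \<in> area_space D i.
     reg_con D i v \<and> balance_con D i v \<and> flow_con D i v \<and> loss_con D i v \<and>
     unit_con D i v \<and> nonanticip_con D i v \<and>
     (i \<in> batt_areas D \<longrightarrow> battery_con D i v) \<and>
     (i \<in> conv_areas D \<longrightarrow> converter_con D i v \<and> peak_con D i v \<and> delivery_con D i v) \<and>
     (i \<in> res_areas D \<longrightarrow> res_con D i v)}"


section \<open>Objective\<close>

definition stage_cost :: "('g, 'h) id_data \<Rightarrow> nat \<Rightarrow> ('g coord \<Rightarrow> real) \<Rightarrow> nat \<Rightarrow> nat \<Rightarrow> real" where
  "stage_cost D i v t m =
     (if i \<in> conv_areas D
      then Delta_ID * (c_buy D i t * v (QPlus t m) - c_sell D i t * v (QMinus t m))
           + c_peak D * v (SPeak m)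
      else 0)
     + (if i \<in> batt_areas D then Delta_ID * c_batt D i * (v (PCh t m) + v (PDis t m)) else 0)
     + (if i \<in> res_areas D then Delta_ID * c_curt D i * (P_res_max D i t m - v (PRes t m)) else 0)
     + Delta_ID * c_reg D i * (P_av D i t m - v (PReg t m))
     + Delta_ID * (\<Sum>g\<in>units_at D i.
         c_gen D g t * v (PGen g t m) + c_pump D g t * v (PPump g t m)
         + a_quad D g t / 2 * (v (PGen g t m) - v (PPump g t m))\<^sup>2)"

definition area_cost :: "('g, 'h) id_data \<Rightarrow> nat \<Rightarrow> ('g coord \<Rightarrow> real) \<Rightarrow> real" where
  "area_cost D i v =
     (\<Sum>m\<in>scens D. scen_prob D m * (\<Sum>t\<in>stages D.
        stage_cost D i v t m + (\<Sum>e | e \<in> line_set D \<and> fst e = i. c_loss D * v (Loss e t m) * Delta_ID)))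
     + (if i \<in> batt_areas D
        then w_soc D i / 2 * (\<Sum>m\<in>scens D. scen_prob D m *
               (\<Sum>t\<in>stages D. (v (Soc (t + 1) m) - E_ref D i (t + 1))\<^sup>2))
        else 0)
     + eps_reg D i / 2 * (L2_set v (coords D i))\<^sup>2"

definition total_cost :: "('g, 'h) id_data \<Rightarrow> (nat \<Rightarrow> 'g coord \<Rightarrow> real) \<Rightarrow> real" where
  "total_cost D x = (\<Sum>i\<in>areas D. area_cost D i (x i))"


section \<open>The intraday problem (ID), its Lagrangian and the ADMM iteration\<close>

text \<open>
  A block is a function of the slot \<open>(t, m)\<close>. Families \<open>x\<close>, \<open>z\<close>, \<open>y\<close> are read only at areas \<open>i\<close>, at
  \<open>a \<in> hood D i\<close> and at slots of \<open>D\<close>; their other values are irrelevant. \<open>y i a\<close> is the multiplier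
  of the constraint equating the copy of angle \<open>a\<close> held by \<open>i\<close> with \<open>z a\<close>.
\<close>

type_synonym block = "nat \<times> nat \<Rightarrow> real"

definition sel :: "nat \<Rightarrow> ('g coord \<Rightarrow> real) \<Rightarrow> block" where
  "sel a v = (\<lambda>(t, m). v (Angle a t m))"

definition id_feasible ::
  "('g, 'h) id_data \<Rightarrow> (nat \<Rightarrow> 'g coord \<Rightarrow> real) \<Rightarrow> (nat \<Rightarrow> block) \<Rightarrow> bool" where
  "id_feasible D x z \<longleftrightarrow>
     (\<forall>i\<in>areas D. x i \<in> local_set D i) \<and>
     (\<forall>i\<in>areas D. \<forall>a\<in>hood D i. \<forall>\<tau>\<in>slots D. sel a (x i) \<tau> = z a \<tau>) \<and>
     (\<forall>\<tau>\<in>slots D. z (ref_area D) \<tau> = 0)"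

definition id_optimal ::
  "('g, 'h) id_data \<Rightarrow> (nat \<Rightarrow> 'g coord \<Rightarrow> real) \<Rightarrow> (nat \<Rightarrow> block) \<Rightarrow> bool" where
  "id_optimal D x z \<longleftrightarrow>
     is_arg_min (\<lambda>(x, z). total_cost D x) (\<lambda>(x, z). id_feasible D x z) (x, z)"

definition id_value :: "('g, 'h) id_data \<Rightarrow> ereal" where
  "id_value D = (INF (x, z) \<in> {(x, z). id_feasible D x z}. ereal (total_cost D x))"

definition lagr_domain ::
  "('g, 'h) id_data \<Rightarrow> ((nat \<Rightarrow> 'g coord \<Rightarrow> real) \<times> (nat \<Rightarrow> block)) set" where
  "lagr_domain D = {(x, z). (\<forall>i\<in>areas D. x i \<in> local_set D i) \<and> (\<forall>\<tau>\<in>slots D. z (ref_area D) \<tau> = 0)}"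

definition lagrangian ::
  "('g, 'h) id_data \<Rightarrow> (nat \<Rightarrow> 'g coord \<Rightarrow> real) \<Rightarrow> (nat \<Rightarrow> block) \<Rightarrow> (nat \<Rightarrow> nat \<Rightarrow> block) \<Rightarrow> real" where
  "lagrangian D x z y =
     (\<Sum>i\<in>areas D. area_cost D i (x i) +
        (\<Sum>a\<in>hood D i. \<Sum>\<tau>\<in>slots D. y i a \<tau> * (sel a (x i) \<tau> - z a \<tau>)))"

definition saddle_point ::
  "('g, 'h) id_data \<Rightarrow> (nat \<Rightarrow> 'g coord \<Rightarrow> real) \<Rightarrow> (nat \<Rightarrow> block) \<Rightarrow> (nat \<Rightarrow> nat \<Rightarrow> block) \<Rightarrow> bool" where
  "saddle_point D xs zs ys \<longleftrightarrow>
     (xs, zs) \<in> lagr_domain D \<and>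
     (\<forall>y. lagrangian D xs zs y \<le> lagrangian D xs zs ys) \<and>
     (\<forall>(x, z) \<in> lagr_domain D. lagrangian D xs zs ys \<le> lagrangian D x z ys)"

definition dual_function :: "('g, 'h) id_data \<Rightarrow> (nat \<Rightarrow> nat \<Rightarrow> block) \<Rightarrow> ereal" where
  "dual_function D y = (INF (x, z) \<in> lagr_domain D. ereal (lagrangian D x z y))"

definition dual_solution :: "('g, 'h) id_data \<Rightarrow> (nat \<Rightarrow> nat \<Rightarrow> block) \<Rightarrow> bool" where
  "dual_solution D ys \<longleftrightarrow> is_arg_max (dual_function D) (\<lambda>y. True) ys"

definition x_objective ::
  "('g, 'h) id_data \<Rightarrow> real \<Rightarrow> nat \<Rightarrow> (nat \<Rightarrow> block) \<Rightarrow> (nat \<Rightarrow> nat \<Rightarrow> block) \<Rightarrow> ('g coord \<Rightarrow> real) \<Rightarrow> real"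
  where
  "x_objective D \<rho> i z y v =
     area_cost D i v +
     (\<Sum>a\<in>hood D i. (\<Sum>\<tau>\<in>slots D. y i a \<tau> * (sel a v \<tau> - z a \<tau>))
        + \<rho> / 2 * (L2_set (\<lambda>\<tau>. sel a v \<tau> - z a \<tau>) (slots D))\<^sup>2)"

text \<open>The starting values \<open>z 0\<close> and \<open>y 0\<close> are arbitrary; \<open>x 0\<close> is not used.\<close>

definition admm_iterates ::
  "('g, 'h) id_data \<Rightarrow> real \<Rightarrow> (nat \<Rightarrow> nat \<Rightarrow> 'g coord \<Rightarrow> real) \<Rightarrow> (nat \<Rightarrow> nat \<Rightarrow> block)
     \<Rightarrow> (nat \<Rightarrow> nat \<Rightarrow> nat \<Rightarrow> block) \<Rightarrow> bool" where
  "admm_iterates D \<rho> x z y \<longleftrightarrow> (\<forall>k.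
     (\<forall>i\<in>areas D. is_arg_min (x_objective D \<rho> i (z k) (y k)) (\<lambda>v. v \<in> local_set D i) (x (Suc k) i)) \<and>
     (\<forall>a\<in>areas D - {ref_area D}. \<forall>\<tau>\<in>slots D.
        z (Suc k) a \<tau> = 1 / (1 + real (card (nbrs D a))) *
          (\<Sum>i\<in>hood D a. sel a (x (Suc k) i) \<tau> + 1 / \<rho> * y k i a \<tau>)) \<and>
     (\<forall>\<tau>\<in>slots D. z (Suc k) (ref_area D) \<tau> = 0) \<and>
     (\<forall>i\<in>areas D. \<forall>a\<in>hood D i. \<forall>\<tau>\<in>slots D.
        y (Suc k) i a \<tau> = y k i a \<tau> + \<rho> * (sel a (x (Suc k) i) \<tau> - z (Suc k) a \<tau>)))"

definition primal_residual ::
  "(nat \<Rightarrow> 'g coord \<Rightarrow> real) \<Rightarrow> (nat \<Rightarrow> block) \<Rightarrow> nat \<Rightarrow> nat \<Rightarrow> block" where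
  "primal_residual x z i a = (\<lambda>\<tau>. sel a (x i) \<tau> - z a \<tau>)"

text \<open>Convergence of stacked blocks; it is coordinatewise because there are finitely many coordinates.\<close>

definition stacked_tendsto ::
  "('g, 'h) id_data \<Rightarrow> (nat \<Rightarrow> nat \<Rightarrow> nat \<Rightarrow> block) \<Rightarrow> (nat \<Rightarrow> nat \<Rightarrow> block) \<Rightarrow> bool" where
  "stacked_tendsto D u l \<longleftrightarrow>
     (\<forall>i\<in>areas D. \<forall>a\<in>hood D i. \<forall>\<tau>\<in>slots D. (\<lambda>k. u k i a \<tau>) \<longlonglongrightarrow> l i a \<tau>)"

definition accumulation_point ::
  "('g, 'h) id_data \<Rightarrow> (nat \<Rightarrow> nat \<Rightarrow> 'g coord \<Rightarrow> real) \<Rightarrow> (nat \<Rightarrow> nat \<Rightarrow> block)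
     \<Rightarrow> (nat \<Rightarrow> 'g coord \<Rightarrow> real) \<Rightarrow> (nat \<Rightarrow> block) \<Rightarrow> bool" where
  "accumulation_point D x z xb zb \<longleftrightarrow>
     (\<forall>i\<in>areas D. xb i \<in> area_space D i) \<and>
     (\<exists>\<phi>. strict_mono \<phi> \<and>
        (\<forall>i\<in>areas D. \<forall>c\<in>coords D i. (\<lambda>k. x (\<phi> k) i c) \<longlonglongrightarrow> xb i c) \<and>
        (\<forall>a\<in>areas D. \<forall>\<tau>\<in>slots D. (\<lambda>k. z (\<phi> k) a \<tau>) \<longlonglongrightarrow> zb a \<tau>))"


section \<open>Centralized physical problem\<close>

text \<open>
  A centralized point consists of asset and loss variables \<open>w i\<close>, one angle block \<open>\<theta> a\<close> per area and
  one flow block \<open>p e\<close> per line. \<open>expand\<close> substitutes \<open>\<theta> a\<close> and \<open>p e\<close> for the copies in the variables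
  of area \<open>i\<close>; the values of \<open>w i\<close> at copy names or off \<open>coords D i\<close> are irrelevant.
\<close>

fun is_copy :: "'g coord \<Rightarrow> bool" where
  "is_copy (Angle a t m) = True"
| "is_copy (Flow e t m) = True"
| "is_copy _ = False"

definition expand ::
  "('g, 'h) id_data \<Rightarrow> (nat \<Rightarrow> 'g coord \<Rightarrow> real) \<Rightarrow> (nat \<Rightarrow> block) \<Rightarrow> (nat \<times> nat \<Rightarrow> block)
     \<Rightarrow> nat \<Rightarrow> 'g coord \<Rightarrow> real" where
  "expand D w \<theta> p i c =
     (if c \<in> coords D i
      then (case c of Angle a t m \<Rightarrow> \<theta> a (t, m) | Flow e t m \<Rightarrow> p e (t, m) | _ \<Rightarrow> w i c)
      else 0)"

definition central_feasible ::
  "('g, 'h) id_data \<Rightarrow> (nat \<Rightarrow> 'g coord \<Rightarrow> real) \<Rightarrow> (nat \<Rightarrow> block) \<Rightarrow> (nat \<times> nat \<Rightarrow> block) \<Rightarrow> bool" where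
  "central_feasible D w \<theta> p \<longleftrightarrow>
     (\<forall>\<tau>\<in>slots D. \<theta> (ref_area D) \<tau> = 0) \<and>
     (\<forall>e\<in>line_set D. \<forall>\<tau>\<in>slots D. p e \<tau> = suscept D e * (\<theta> (fst e) \<tau> - \<theta> (snd e) \<tau>)) \<and>
     (\<forall>i\<in>areas D. expand D w \<theta> p i \<in> local_set D i)"

definition central_optimal ::
  "('g, 'h) id_data \<Rightarrow> (nat \<Rightarrow> 'g coord \<Rightarrow> real) \<Rightarrow> (nat \<Rightarrow> block) \<Rightarrow> (nat \<times> nat \<Rightarrow> block) \<Rightarrow> bool" where
  "central_optimal D w \<theta> p \<longleftrightarrow>
     is_arg_min (\<lambda>(w, \<theta>, p). total_cost D (expand D w \<theta> p))
       (\<lambda>(w, \<theta>, p). central_feasible D w \<theta> p) (w, \<theta>, p)"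

definition corresponds ::
  "('g, 'h) id_data \<Rightarrow> (nat \<Rightarrow> 'g coord \<Rightarrow> real) \<Rightarrow> (nat \<Rightarrow> block)
     \<Rightarrow> (nat \<Rightarrow> 'g coord \<Rightarrow> real) \<Rightarrow> (nat \<Rightarrow> block) \<Rightarrow> (nat \<times> nat \<Rightarrow> block) \<Rightarrow> bool" where
  "corresponds D x z w \<theta> p \<longleftrightarrow>
     (\<forall>a\<in>areas D. \<forall>\<tau>\<in>slots D. \<theta> a \<tau> = z a \<tau>) \<and>
     (\<forall>e\<in>line_set D. \<forall>(t, m)\<in>slots D.
        p e (t, m) = x (fst e) (Flow e t m) \<and> p e (t, m) = x (snd e) (Flow e t m)) \<and>
     (\<forall>i\<in>areas D. \<forall>c\<in>coords D i. \<not> is_copy c \<longrightarrow> w i c = x i c)"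

end

theory Submission
  imports Defs
begin

text \<open>
  The algorithm is ADMM for a convex problem with a linear consensus constraint, and the proof is a
  Lyapunov argument. Let \<open>J\<close> be the optimal value. The Lyapunov function is the weighted sum of the squared
  distances of the multipliers from a dual solution and of the consensus angles from an optimal consensus.
  Each x-update minimizes a convex function plus a quadratic penalty over a convex set, so its result also
  minimizes the cost plus a linear term (\<open>augmented_minimizer_linearized\<close>); comparing with an
  optimal point bounds the cost above, and the dual solution bounds it below. The z-update makes
  the multipliers of each angle sum to zero, so multipliers are orthogonal to all consensus values
  (\<open>dot_stack_spread_eq_0\<close>). With this orthogonality the two bounds combine to a decrease of the
  Lyapunov function by the squared residual and the squared change of the consensus angles
  (\<open>lyapunov_decrease\<close>). Hence residuals vanish, multipliers stay bounded, and costs tend to \<open>J\<close>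
  (\<open>cost_tendsto\<close>).

  Every cluster point of the multipliers is a dual solution (\<open>cluster_point_multiplier\<close>). Since
  the Lyapunov function converges for every dual solution, two cluster points coincide
  (\<open>cluster_points_agree\<close>), so the multipliers converge. The local variables need neither converge nor stay
  bounded; the argument uses only their costs and the angle copies, which is why it is carried out for an
  abstract set of attainable pairs of cost and copies.

  Local sets are given by finitely many affine conditions and the costs are continuous, so accumulation
  points of the primal iterates are feasible with cost \<open>J\<close>. Finally, in a feasible point both
  holders of a line have the same flow copy, determined by the common angles (\<open>flow_of_angles\<close>); therefore the
  centralized problem has the same feasible points, up to renaming, and the same cost.
\<close>

section \<open>Consensus ADMM with an abstract set of attainable costs\<close>

definition dot :: "'k set \<Rightarrow> ('k \<Rightarrow> real) \<Rightarrow> ('k \<Rightarrow> real) \<Rightarrow> real" where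
  "dot K u v = (\<Sum>\<kappa>\<in>K. u \<kappa> * v \<kappa>)"

lemma dot_add_left: "dot K (\<lambda>\<kappa>. u \<kappa> + v \<kappa>) w = dot K u w + dot K v w"
  and dot_diff_left: "dot K (\<lambda>\<kappa>. u \<kappa> - v \<kappa>) w = dot K u w - dot K v w"
  and dot_scale_left: "dot K (\<lambda>\<kappa>. c * u \<kappa>) w = c * dot K u w"
  by (simp_all add: dot_def algebra_simps sum.distrib sum_subtractf sum_distrib_left)

lemma dot_diff_right: "dot K w (\<lambda>\<kappa>. u \<kappa> - v \<kappa>) = dot K w u - dot K w v"
  by (simp add: dot_def algebra_simps sum_subtractf)

lemma dot_cong:
  assumes "\<And>\<kappa>. \<kappa> \<in> K \<Longrightarrow> u \<kappa> = u' \<kappa>" "\<And>\<kappa>. \<kappa> \<in> K \<Longrightarrow> v \<kappa> = v' \<kappa>"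
  shows "dot K u v = dot K u' v'"
  unfolding dot_def using assms by (intro sum.cong) auto

lemma dot_self_nonneg: "0 \<le> dot K u u"
  by (simp add: dot_def sum_nonneg)

lemma square_le_dot_self:
  assumes "finite K" "\<kappa> \<in> K"
  shows "(u \<kappa>)\<^sup>2 \<le> dot K u u"
  using assms member_le_sum[of \<kappa> K "\<lambda>\<kappa>. u \<kappa> * u \<kappa>"]
  by (simp add: dot_def power2_eq_square)

lemma tendsto_dot:
  assumes "\<And>\<kappa>. \<kappa> \<in> K \<Longrightarrow> (\<lambda>k. u k \<kappa>) \<longlonglongrightarrow> u' \<kappa>" "\<And>\<kappa>. \<kappa> \<in> K \<Longrightarrow> (\<lambda>k. v k \<kappa>) \<longlonglongrightarrow> v' \<kappa>"
  shows "(\<lambda>k. dot K (u k) (v k)) \<longlonglongrightarrow> dot K u' v'"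
  unfolding dot_def using assms by (intro tendsto_intros) auto

lemma tendsto_dot_bounded_null:
  assumes "\<And>\<kappa> k. \<kappa> \<in> K \<Longrightarrow> \<bar>u k \<kappa>\<bar> \<le> B" "\<And>\<kappa>. \<kappa> \<in> K \<Longrightarrow> (\<lambda>k. v k \<kappa>) \<longlonglongrightarrow> 0"
  shows "(\<lambda>k. dot K (u k) (v k)) \<longlonglongrightarrow> 0"
proof -
  have "(\<lambda>k. \<Sum>\<kappa>\<in>K. u k \<kappa> * v k \<kappa>) \<longlonglongrightarrow> (\<Sum>\<kappa>\<in>K. 0)"
    using assms by (intro tendsto_sum lim_null_mult_left_bounded[where B = B]) auto
  then show ?thesis by (simp add: dot_def)
qed

lemma convergent_subsequence_finite:
  fixes u :: "nat \<Rightarrow> 'k \<Rightarrow> real"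
  assumes "finite K" "\<forall>\<kappa>\<in>K. \<forall>k. \<bar>u k \<kappa>\<bar> \<le> B"
  shows "\<exists>l r. strict_mono (r :: nat \<Rightarrow> nat) \<and> (\<forall>\<kappa>\<in>K. (\<lambda>k. u (r k) \<kappa>) \<longlonglongrightarrow> l \<kappa>)"
proof -
  have "\<forall>d\<subseteq>K. \<exists>l::'k \<Rightarrow> real. \<exists>r::nat \<Rightarrow> nat.
      strict_mono r \<and> (\<forall>e>0. eventually (\<lambda>n. \<forall>i\<in>d. dist (u (r n) i) (l i) < e) sequentially)"
    using assms
    by (intro compact_lemma_general[where proj = "\<lambda>f \<kappa>. f \<kappa>" and unproj = "\<lambda>f. f"])
      (auto simp: bounded_iff)
  then obtain l :: "'k \<Rightarrow> real" and r :: "nat \<Rightarrow> nat" where r: "strict_mono r"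
    "\<forall>e>0. eventually (\<lambda>n. \<forall>i\<in>K. dist (u (r n) i) (l i) < e) sequentially"
    by blast
  have "(\<lambda>k. u (r k) \<kappa>) \<longlonglongrightarrow> l \<kappa>" if "\<kappa> \<in> K" for \<kappa>
  proof (rule tendstoI)
    fix e :: real assume "e > 0"
    then show "\<forall>\<^sub>F n in sequentially. dist (u (r n) \<kappa>) (l \<kappa>) < e"
      using r(2) that by (auto elim!: eventually_mono)
  qed
  with r(1) show ?thesis by blast
qed

text \<open>
  ADMM sees the primal problem only through the pairs (cost, copies) that local decisions can produce;
  \<open>S\<close> is the set of these pairs, \<open>K\<close> indexes the coordinates of the copies, and \<open>W\<close> holds the values of
  the copies on which all areas agree. \<open>P k\<close> and \<open>A k\<close> are cost and copies of the k-th decision, \<open>U k\<close> is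
  the consensus value and \<open>Y k\<close> the multiplier. The local decisions themselves may be unbounded (a cost
  can be flat in a direction without bound), so the argument never takes limits of them. \<open>Y_orth\<close> is what
  averaging in the z-update achieves; it holds from the first update on, which is why index 0 here will
  be iterate 1 of the algorithm.
\<close>

locale consensus_admm =
  fixes K :: "'k set" and W :: "('k \<Rightarrow> real) set" and S :: "(real \<times> ('k \<Rightarrow> real)) set"
    and \<rho> J :: real and P :: "nat \<Rightarrow> real" and A U Y :: "nat \<Rightarrow> 'k \<Rightarrow> real" and Us :: "'k \<Rightarrow> real"
  assumes finite_K: "finite K"
    and rho_pos: "\<rho> > 0"
    and U_in: "U k \<in> W"
    and Y_orth: "w \<in> W \<Longrightarrow> dot K (Y k) w = 0"
    and A_in: "(P k, A k) \<in> S"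
    and Y_step: "\<kappa> \<in> K \<Longrightarrow> Y (Suc k) \<kappa> = Y k \<kappa> + \<rho> * (A (Suc k) \<kappa> - U (Suc k) \<kappa>)"
    and x_step: "(c, v) \<in> S \<Longrightarrow>
      P (Suc k) + dot K (\<lambda>\<kappa>. Y (Suc k) \<kappa> + \<rho> * (U (Suc k) \<kappa> - U k \<kappa>)) (A (Suc k))
      \<le> c + dot K (\<lambda>\<kappa>. Y (Suc k) \<kappa> + \<rho> * (U (Suc k) \<kappa> - U k \<kappa>)) v"
    and opt_S: "(J, Us) \<in> S"
    and opt_W: "Us \<in> W"
begin

text \<open>
  If such a vector exists, these are exactly the dual solutions: by weak duality the dual function
  never exceeds the optimal value, so its maximizers are the vectors that reach this value.
\<close>

definition multiplier :: "('k \<Rightarrow> real) \<Rightarrow> bool" where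
  "multiplier y \<longleftrightarrow> (\<forall>(c, v) \<in> S. \<forall>w\<in>W. J \<le> c + dot K y (\<lambda>\<kappa>. v \<kappa> - w \<kappa>))"

definition residual :: "nat \<Rightarrow> 'k \<Rightarrow> real" where
  "residual k = (\<lambda>\<kappa>. A k \<kappa> - U k \<kappa>)"

definition shift :: "nat \<Rightarrow> 'k \<Rightarrow> real" where
  "shift k = (\<lambda>\<kappa>. U (Suc k) \<kappa> - U k \<kappa>)"

definition lyapunov :: "('k \<Rightarrow> real) \<Rightarrow> nat \<Rightarrow> real" where
  "lyapunov ys k = dot K (\<lambda>\<kappa>. Y k \<kappa> - ys \<kappa>) (\<lambda>\<kappa>. Y k \<kappa> - ys \<kappa>) / \<rho>
     + \<rho> * dot K (\<lambda>\<kappa>. U k \<kappa> - Us \<kappa>) (\<lambda>\<kappa>. U k \<kappa> - Us \<kappa>)"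

text \<open>
  The residual is proportional to the change of the multiplier, hence orthogonal to \<open>W\<close>, whereas
  the shift is a difference of two elements of \<open>W\<close>. This removes the cross term that would otherwise
  need a separate sign argument in the descent estimate.
\<close>

lemma shift_orth_residual: "dot K (shift k) (residual (Suc k)) = 0"
proof -
  have "\<rho> * dot K (shift k) (residual (Suc k)) = dot K (\<lambda>\<kappa>. \<rho> * residual (Suc k) \<kappa>) (shift k)"
    by (simp add: dot_scale_left) (simp add: dot_def mult.commute)
  also have "\<dots> = dot K (\<lambda>\<kappa>. Y (Suc k) \<kappa> - Y k \<kappa>) (shift k)"
    by (rule dot_cong) (auto simp: Y_step residual_def)
  also have "\<dots> = 0"
    unfolding shift_def by (simp add: dot_diff_left dot_diff_right Y_orth U_in)
  finally show ?thesis using rho_pos by simp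
qed

text \<open>
  This is the optimality of the x-update, with the terms sorted into those that vanish in the limit
  (left, residual and shift) and the value of the competitor.
\<close>

lemma cost_upper:
  assumes "(c, v) \<in> S"
  shows "P (Suc k) + dot K (Y (Suc k)) (residual (Suc k)) + \<rho> * dot K (shift k) (U (Suc k))
    \<le> c + dot K (Y (Suc k)) v + \<rho> * dot K (shift k) v"
proof -
  have A: "dot K w (A (Suc k)) = dot K w (residual (Suc k)) + dot K w (U (Suc k))" for w
    by (simp add: residual_def dot_diff_right)
  show ?thesis
    using x_step[OF assms, of k] shift_orth_residual[of k]
    unfolding shift_def[symmetric, THEN fun_cong]
    by (simp add: A dot_add_left dot_scale_left Y_orth U_in algebra_simps)
qed

lemma cost_lower:
  assumes "multiplier ys"
  shows "J \<le> P k + dot K ys (residual k)"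
  using assms A_in[of k] U_in[of k] unfolding multiplier_def residual_def by fastforce

text \<open>
  Add the lower bound of the cost by the multiplier \<open>ys\<close> to the upper bound obtained from the optimal
  competitor: the costs cancel and what is left is a sign condition on inner products. Polarization
  turns these into differences of squared distances.
\<close>

lemma lyapunov_decrease:
  assumes "multiplier ys"
  shows "lyapunov ys (Suc k) + \<rho> * dot K (residual (Suc k)) (residual (Suc k)) + \<rho> * dot K (shift k) (shift k)
    \<le> lyapunov ys k"
proof -
  let ?e = "\<lambda>\<kappa>. Y (Suc k) \<kappa> - ys \<kappa>" and ?d = "\<lambda>\<kappa>. U (Suc k) \<kappa> - Us \<kappa>"
  have "P (Suc k) + dot K (Y (Suc k)) (residual (Suc k)) + \<rho> * dot K (shift k) (U (Suc k))
      \<le> J + \<rho> * dot K (shift k) Us"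
    using cost_upper[OF opt_S, of k] by (simp add: Y_orth opt_W)
  with cost_lower[OF assms, of "Suc k"]
  have neg: "dot K ?e (residual (Suc k)) + \<rho> * dot K (shift k) ?d \<le> 0"
    by (simp add: dot_diff_left dot_diff_right algebra_simps)
  have Y: "dot K (\<lambda>\<kappa>. Y k \<kappa> - ys \<kappa>) (\<lambda>\<kappa>. Y k \<kappa> - ys \<kappa>)
      = dot K ?e ?e - 2 * \<rho> * dot K ?e (residual (Suc k)) + \<rho>\<^sup>2 * dot K (residual (Suc k)) (residual (Suc k))"
    unfolding dot_def sum_distrib_left sum_subtractf[symmetric] sum.distrib[symmetric]
    by (intro sum.cong refl) (simp add: Y_step residual_def power2_eq_square algebra_simps)
  have U: "dot K (\<lambda>\<kappa>. U k \<kappa> - Us \<kappa>) (\<lambda>\<kappa>. U k \<kappa> - Us \<kappa>)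
      = dot K ?d ?d - 2 * dot K (shift k) ?d + dot K (shift k) (shift k)"
    unfolding dot_def sum_distrib_left sum_subtractf[symmetric] sum.distrib[symmetric]
    by (intro sum.cong refl) (simp add: shift_def power2_eq_square algebra_simps)
  have "lyapunov ys k = lyapunov ys (Suc k) + \<rho> * dot K (residual (Suc k)) (residual (Suc k)) + \<rho> * dot K (shift k) (shift k)
      - 2 * (dot K ?e (residual (Suc k)) + \<rho> * dot K (shift k) ?d)"
    unfolding lyapunov_def Y U using rho_pos by (simp add: field_simps power2_eq_square)
  with neg show ?thesis by simp
qed

lemma lyapunov_nonneg: "0 \<le> lyapunov ys k"
  unfolding lyapunov_def using rho_pos by (simp add: dot_self_nonneg)

lemma lyapunov_mono:
  assumes "multiplier ys"
  shows "lyapunov ys (Suc k) \<le> lyapunov ys k"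
  using lyapunov_decrease[OF assms, of k] rho_pos dot_self_nonneg[of K "residual (Suc k)"] dot_self_nonneg[of K "shift k"]
  by (smt (verit) mult_nonneg_nonneg)

lemma lyapunov_convergent:
  assumes "multiplier ys"
  shows "convergent (lyapunov ys)"
proof -
  have "decseq (lyapunov ys)" using lyapunov_mono[OF assms] by (rule decseq_SucI)
  then obtain L where "lyapunov ys \<longlonglongrightarrow> L"
    using decseq_convergent[of "lyapunov ys" 0] lyapunov_nonneg by metis
  then show ?thesis by (rule convergentI)
qed

text \<open>
  Both squared distances are controlled by the initial value of the Lyapunov function.
\<close>

lemma Y_U_bounded:
  assumes "multiplier ys"
  shows "\<exists>B. \<forall>\<kappa>\<in>K. \<forall>k. \<bar>Y k \<kappa>\<bar> \<le> B \<and> \<bar>U k \<kappa>\<bar> \<le> B"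
proof -
  define L where "L = lyapunov ys 0"
  define b where "b = sqrt (\<rho> * L) + sqrt (L / \<rho>)"
  have L: "lyapunov ys k \<le> L" for k
    using decseqD[OF decseq_SucI, of "lyapunov ys" 0 k] lyapunov_mono[OF assms] by (simp add: L_def)
  have L0: "L \<ge> 0" using lyapunov_nonneg by (simp add: L_def)
  have nn: "sqrt (\<rho> * L) \<ge> 0" "sqrt (L / \<rho>) \<ge> 0" using L0 rho_pos by simp_all
  have Yb: "\<bar>Y k \<kappa> - ys \<kappa>\<bar> \<le> b" and Ub: "\<bar>U k \<kappa> - Us \<kappa>\<bar> \<le> b" if "\<kappa> \<in> K" for \<kappa> k
  proof -
    have *: "dot K (\<lambda>\<kappa>. Y k \<kappa> - ys \<kappa>) (\<lambda>\<kappa>. Y k \<kappa> - ys \<kappa>) / \<rho> \<le> L"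
      "\<rho> * dot K (\<lambda>\<kappa>. U k \<kappa> - Us \<kappa>) (\<lambda>\<kappa>. U k \<kappa> - Us \<kappa>) \<le> L"
      using L[of k] rho_pos dot_self_nonneg[of K "\<lambda>\<kappa>. Y k \<kappa> - ys \<kappa>"] dot_self_nonneg[of K "\<lambda>\<kappa>. U k \<kappa> - Us \<kappa>"]
      unfolding lyapunov_def
      by (smt (verit) divide_nonneg_pos mult_nonneg_nonneg)+
    have "(Y k \<kappa> - ys \<kappa>)\<^sup>2 \<le> \<rho> * L"
      using *(1) square_le_dot_self[OF finite_K that, of "\<lambda>\<kappa>. Y k \<kappa> - ys \<kappa>"] rho_pos
      by (simp add: field_simps)
    then have "\<bar>Y k \<kappa> - ys \<kappa>\<bar> \<le> sqrt (\<rho> * L)" using real_le_rsqrt[of "\<bar>Y k \<kappa> - ys \<kappa>\<bar>"] by simp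
    then show "\<bar>Y k \<kappa> - ys \<kappa>\<bar> \<le> b" using nn unfolding b_def by linarith
    have "(U k \<kappa> - Us \<kappa>)\<^sup>2 * \<rho> \<le> dot K (\<lambda>\<kappa>. U k \<kappa> - Us \<kappa>) (\<lambda>\<kappa>. U k \<kappa> - Us \<kappa>) * \<rho>"
      using square_le_dot_self[OF finite_K that, of "\<lambda>\<kappa>. U k \<kappa> - Us \<kappa>"] rho_pos
      by (intro mult_right_mono) auto
    with *(2) have "(U k \<kappa> - Us \<kappa>)\<^sup>2 * \<rho> \<le> L"
      by (simp only: mult.commute)
    then have "(U k \<kappa> - Us \<kappa>)\<^sup>2 \<le> L / \<rho>"
      using rho_pos by (simp only: pos_le_divide_eq)
    then have "\<bar>U k \<kappa> - Us \<kappa>\<bar> \<le> sqrt (L / \<rho>)" using real_le_rsqrt[of "\<bar>U k \<kappa> - Us \<kappa>\<bar>"] by simp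
    then show "\<bar>U k \<kappa> - Us \<kappa>\<bar> \<le> b" using nn unfolding b_def by linarith
  qed
  define C where "C = (\<Sum>\<kappa>\<in>K. \<bar>ys \<kappa>\<bar> + \<bar>Us \<kappa>\<bar>)"
  have C: "\<bar>ys \<kappa>\<bar> + \<bar>Us \<kappa>\<bar> \<le> C" if "\<kappa> \<in> K" for \<kappa>
    unfolding C_def using finite_K that by (intro member_le_sum) auto
  have "\<bar>Y k \<kappa>\<bar> \<le> b + C \<and> \<bar>U k \<kappa>\<bar> \<le> b + C" if "\<kappa> \<in> K" for \<kappa> k
    using Yb[OF that, of k] Ub[OF that, of k] C[OF that] by linarith
  then show ?thesis by blast
qed

text \<open>
  The Lyapunov function converges, so its decrements, which dominate these squares, tend to zero.
\<close>

lemma residuals_null: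
  assumes "multiplier ys" "\<kappa> \<in> K"
  shows "(\<lambda>k. residual (Suc k) \<kappa>) \<longlonglongrightarrow> 0" "(\<lambda>k. shift k \<kappa>) \<longlonglongrightarrow> 0"
proof -
  obtain L where "lyapunov ys \<longlonglongrightarrow> L" using lyapunov_convergent[OF assms(1)] by (auto simp: convergent_def)
  then have "(\<lambda>k. (lyapunov ys k - lyapunov ys (Suc k)) / \<rho>) \<longlonglongrightarrow> (L - L) / \<rho>"
    using rho_pos by (intro tendsto_intros) (auto simp: LIMSEQ_Suc)
  then have lim: "(\<lambda>k. (lyapunov ys k - lyapunov ys (Suc k)) / \<rho>) \<longlonglongrightarrow> 0" by simp
  have le: "dot K (residual (Suc k)) (residual (Suc k)) + dot K (shift k) (shift k)
      \<le> (lyapunov ys k - lyapunov ys (Suc k)) / \<rho>" for k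
    using lyapunov_decrease[OF assms(1), of k] rho_pos by (simp add: field_simps)
  have sq: "(residual (Suc k) \<kappa>)\<^sup>2 \<le> (lyapunov ys k - lyapunov ys (Suc k)) / \<rho>"
    "(shift k \<kappa>)\<^sup>2 \<le> (lyapunov ys k - lyapunov ys (Suc k)) / \<rho>" for k
    using le[of k] square_le_dot_self[OF finite_K assms(2), of "residual (Suc k)"]
      square_le_dot_self[OF finite_K assms(2), of "shift k"]
      dot_self_nonneg[of K "residual (Suc k)"] dot_self_nonneg[of K "shift k"] by linarith+
  have "(\<lambda>k. (residual (Suc k) \<kappa>)\<^sup>2) \<longlonglongrightarrow> 0" "(\<lambda>k. (shift k \<kappa>)\<^sup>2) \<longlonglongrightarrow> 0"
    by (rule tendsto_sandwich[OF _ _ tendsto_const lim]; simp add: sq)+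
  then show "(\<lambda>k. residual (Suc k) \<kappa>) \<longlonglongrightarrow> 0" "(\<lambda>k. shift k \<kappa>) \<longlonglongrightarrow> 0"
    using tendsto_real_sqrt by (force simp: tendsto_rabs_zero_iff)+
qed

lemma coupling_null:
  assumes "multiplier ys"
  shows "(\<lambda>k. dot K (Y (Suc k)) (residual (Suc k)) + \<rho> * dot K (shift k) (U (Suc k))) \<longlonglongrightarrow> 0"
proof -
  obtain B where B: "\<And>\<kappa> k. \<kappa> \<in> K \<Longrightarrow> \<bar>Y k \<kappa>\<bar> \<le> B" "\<And>\<kappa> k. \<kappa> \<in> K \<Longrightarrow> \<bar>U k \<kappa>\<bar> \<le> B"
    using Y_U_bounded[OF assms] by blast
  have "(\<lambda>k. dot K (Y (Suc k)) (residual (Suc k))) \<longlonglongrightarrow> 0" "(\<lambda>k. dot K (U (Suc k)) (shift k)) \<longlonglongrightarrow> 0"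
    using B residuals_null[OF assms] by (auto intro!: tendsto_dot_bounded_null[where B = B])
  then have "(\<lambda>k. dot K (Y (Suc k)) (residual (Suc k)) + \<rho> * dot K (U (Suc k)) (shift k)) \<longlonglongrightarrow> 0 + \<rho> * 0"
    by (intro tendsto_intros)
  then show ?thesis by (simp add: dot_def mult.commute)
qed

text \<open>
  The cost is squeezed between the bound given by the multiplier and the bound given by the optimal
  competitor; both differ from \<open>J\<close> by products of bounded and null sequences.
\<close>

lemma cost_tendsto:
  assumes "multiplier ys"
  shows "P \<longlonglongrightarrow> J"
proof -
  have R0: "(\<lambda>k. dot K ys (residual (Suc k))) \<longlonglongrightarrow> dot K ys (\<lambda>_. 0)"
    using residuals_null(1)[OF assms] by (intro tendsto_dot) auto
  have lo: "(\<lambda>k. J - dot K ys (residual (Suc k))) \<longlonglongrightarrow> J - dot K ys (\<lambda>_. 0)"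
    using R0 by (intro tendsto_intros)
  have dU0: "(\<lambda>k. dot K (shift k) Us) \<longlonglongrightarrow> dot K (\<lambda>_. 0) Us"
    using residuals_null(2)[OF assms] by (intro tendsto_dot) auto
  have up: "(\<lambda>k. J + \<rho> * dot K (shift k) Us - (dot K (Y (Suc k)) (residual (Suc k)) + \<rho> * dot K (shift k) (U (Suc k))))
      \<longlonglongrightarrow> J + \<rho> * dot K (\<lambda>_. 0) Us - 0"
    using dU0 coupling_null[OF assms] by (intro tendsto_intros)
  have "(\<lambda>k. P (Suc k)) \<longlonglongrightarrow> J"
  proof (rule tendsto_sandwich)
    show "(\<lambda>k. J - dot K ys (residual (Suc k))) \<longlonglongrightarrow> J" using lo by (simp add: dot_def)
    show "(\<lambda>k. J + \<rho> * dot K (shift k) Us - (dot K (Y (Suc k)) (residual (Suc k)) + \<rho> * dot K (shift k) (U (Suc k))))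
      \<longlonglongrightarrow> J" using up by (simp add: dot_def)
    show "\<forall>\<^sub>F k in sequentially. J - dot K ys (residual (Suc k)) \<le> P (Suc k)"
      using cost_lower[OF assms] by (simp add: algebra_simps)
    show "\<forall>\<^sub>F k in sequentially. P (Suc k)
       \<le> J + \<rho> * dot K (shift k) Us - (dot K (Y (Suc k)) (residual (Suc k)) + \<rho> * dot K (shift k) (U (Suc k)))"
      using cost_upper[OF opt_S] by (simp add: Y_orth opt_W algebra_simps)
  qed
  then show ?thesis by (simp add: filterlim_sequentially_Suc)
qed

text \<open>
  Pass to the limit in the optimality of the x-update against an arbitrary competitor. On the left
  side only the cost, the coupling term and the multipliers occur, and their limits are known although
  the decisions themselves need not converge.
\<close>

lemma cluster_point_multiplier:
  assumes "multiplier ys" "strict_mono r" "\<And>\<kappa>. \<kappa> \<in> K \<Longrightarrow> (\<lambda>k. Y (r k) \<kappa>) \<longlonglongrightarrow> yb \<kappa>"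
  shows "multiplier yb"
proof -
  \<comment> \<open>The estimates speak of index \<open>Suc k\<close>, so the subsequence is shifted to reach \<open>r (Suc k) > 0\<close>.\<close>
  define r' where "r' k = r (Suc k) - 1" for k
  have r_pos: "r (Suc k) > 0" for k
    using strict_mono_less[OF assms(2), of k "Suc k"] by simp
  then have Suc_r': "Suc (r' k) = r (Suc k)" for k by (simp add: r'_def)
  have mono: "strict_mono r'"
    unfolding strict_mono_Suc_iff using Suc_r' assms(2)
    by (metis Suc_less_eq lessI strict_mono_less)
  have Ylim: "(\<lambda>k. Y (Suc (r' k)) \<kappa>) \<longlonglongrightarrow> yb \<kappa>" if "\<kappa> \<in> K" for \<kappa>
    unfolding Suc_r' using LIMSEQ_Suc[OF assms(3)[OF that]] .
  have sub: "f \<longlonglongrightarrow> l \<Longrightarrow> (\<lambda>k. f (r' k)) \<longlonglongrightarrow> l" for f :: "nat \<Rightarrow> real" and l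
    using LIMSEQ_subseq_LIMSEQ[OF _ mono] by (auto simp: o_def)
  have orth: "dot K yb w = 0" if "w \<in> W" for w
  proof (rule LIMSEQ_unique)
    show "(\<lambda>k. dot K (Y (Suc (r' k))) w) \<longlonglongrightarrow> dot K yb w"
      by (intro tendsto_dot Ylim tendsto_const)
    show "(\<lambda>k. dot K (Y (Suc (r' k))) w) \<longlonglongrightarrow> 0"
      using that by (simp add: Y_orth)
  qed
  have "J \<le> c + dot K yb v" if "(c, v) \<in> S" for c v
  proof -
    let ?lhs = "\<lambda>k. P (Suc k) + (dot K (Y (Suc k)) (residual (Suc k)) + \<rho> * dot K (shift k) (U (Suc k)))"
    let ?rhs = "\<lambda>k. c + dot K (Y (Suc (r' k))) v + \<rho> * dot K (shift (r' k)) v"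
    have "?lhs \<longlonglongrightarrow> J + 0"
      using LIMSEQ_Suc[OF cost_tendsto[OF assms(1)]] coupling_null[OF assms(1)]
      by (intro tendsto_add)
    then have 1: "(\<lambda>k. ?lhs (r' k)) \<longlonglongrightarrow> J" by (intro sub) simp
    have 2: "?rhs \<longlonglongrightarrow> c + dot K yb v + \<rho> * dot K (\<lambda>_. 0) v"
      by (intro tendsto_intros tendsto_dot Ylim sub residuals_null(2)[OF assms(1)])
    have "J \<le> c + dot K yb v + \<rho> * dot K (\<lambda>_. 0) v"
      using 1 2 cost_upper[OF that]
      by (intro LIMSEQ_le[OF 1 2]) (auto simp: add.assoc)
    then show ?thesis by (simp add: dot_def)
  qed
  then show ?thesis
    unfolding multiplier_def by (auto simp: dot_diff_right orth)
qed

text \<open>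
  Opial's argument: the Lyapunov function converges for both multipliers, with the same second
  summand. Its difference is affine in \<open>Y k\<close> with gradient proportional to \<open>y' - y\<close>, so
  the inner product of \<open>Y k\<close> with this vector converges, and both cluster points give it the same value.
\<close>

lemma cluster_points_agree:
  assumes y: "multiplier y" "multiplier y'"
    and r: "strict_mono r" "\<And>\<kappa>. \<kappa> \<in> K \<Longrightarrow> (\<lambda>k. Y (r k) \<kappa>) \<longlonglongrightarrow> y \<kappa>"
    and r': "strict_mono r'" "\<And>\<kappa>. \<kappa> \<in> K \<Longrightarrow> (\<lambda>k. Y (r' k) \<kappa>) \<longlonglongrightarrow> y' \<kappa>"
    and "\<kappa> \<in> K"
  shows "y \<kappa> = y' \<kappa>"
proof -
  let ?d = "\<lambda>\<kappa>. y' \<kappa> - y \<kappa>"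
  have id: "dot K (Y k) ?d = (\<rho> * (lyapunov y k - lyapunov y' k) + (dot K y' y' - dot K y y)) / 2" for k
  proof -
    have "\<rho> * (lyapunov y k - lyapunov y' k) = dot K (\<lambda>\<kappa>. Y k \<kappa> - y \<kappa>) (\<lambda>\<kappa>. Y k \<kappa> - y \<kappa>)
        - dot K (\<lambda>\<kappa>. Y k \<kappa> - y' \<kappa>) (\<lambda>\<kappa>. Y k \<kappa> - y' \<kappa>)"
      using rho_pos by (simp add: lyapunov_def field_simps)
    also have "\<dots> = 2 * dot K (Y k) ?d - (dot K y' y' - dot K y y)"
      unfolding dot_def sum_distrib_left sum_subtractf[symmetric]
      by (intro sum.cong refl) (simp add: algebra_simps)
    finally show ?thesis by simp
  qed
  obtain L L' where "lyapunov y \<longlonglongrightarrow> L" "lyapunov y' \<longlonglongrightarrow> L'"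
    using y lyapunov_convergent unfolding convergent_def by blast
  then have "(\<lambda>k. dot K (Y k) ?d) \<longlonglongrightarrow> (\<rho> * (L - L') + (dot K y' y' - dot K y y)) / 2"
    unfolding id by (intro tendsto_intros) auto
  then obtain l where l: "(\<lambda>k. dot K (Y k) ?d) \<longlonglongrightarrow> l" by blast
  have "(\<lambda>k. dot K (Y (r k)) ?d) \<longlonglongrightarrow> dot K y ?d"
    by (intro tendsto_dot r(2) tendsto_const)
  moreover have "(\<lambda>k. dot K (Y (r k)) ?d) \<longlonglongrightarrow> l"
    using LIMSEQ_subseq_LIMSEQ[OF l r(1)] by (simp add: o_def)
  ultimately have 1: "dot K y ?d = l" by (rule LIMSEQ_unique)
  have "(\<lambda>k. dot K (Y (r' k)) ?d) \<longlonglongrightarrow> dot K y' ?d"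
    by (intro tendsto_dot r'(2) tendsto_const)
  moreover have "(\<lambda>k. dot K (Y (r' k)) ?d) \<longlonglongrightarrow> l"
    using LIMSEQ_subseq_LIMSEQ[OF l r'(1)] by (simp add: o_def)
  ultimately have 2: "dot K y' ?d = l" by (rule LIMSEQ_unique)
  have "dot K ?d ?d = 0" using 1 2 by (simp add: dot_diff_left)
  then have "(?d \<kappa>)\<^sup>2 \<le> 0" using square_le_dot_self[OF finite_K \<open>\<kappa> \<in> K\<close>, of ?d] by simp
  then show ?thesis by simp
qed

text \<open>
  A bounded sequence in finite dimension with a single cluster point converges.
\<close>

lemma Y_tendsto_multiplier:
  assumes "multiplier ys"
  shows "\<exists>yb. multiplier yb \<and> (\<forall>\<kappa>\<in>K. (\<lambda>k. Y k \<kappa>) \<longlonglongrightarrow> yb \<kappa>)"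
proof -
  obtain B where B: "\<forall>\<kappa>\<in>K. \<forall>k. \<bar>Y k \<kappa>\<bar> \<le> B"
    using Y_U_bounded[OF assms] by blast
  obtain yb r where r: "strict_mono (r :: nat \<Rightarrow> nat)" and "\<forall>\<kappa>\<in>K. (\<lambda>k. Y (r k) \<kappa>) \<longlonglongrightarrow> yb \<kappa>"
    using convergent_subsequence_finite[OF finite_K B] by blast
  then have r2: "(\<lambda>k. Y (r k) \<kappa>) \<longlonglongrightarrow> yb \<kappa>" if "\<kappa> \<in> K" for \<kappa>
    using that by blast
  have yb: "multiplier yb" using cluster_point_multiplier[OF assms r r2] .
  have "(\<lambda>k. Y k \<kappa>) \<longlonglongrightarrow> yb \<kappa>" if "\<kappa> \<in> K" for \<kappa>
  proof (rule ccontr)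
    assume "\<not> (\<lambda>k. Y k \<kappa>) \<longlonglongrightarrow> yb \<kappa>"
    then obtain e where e: "e > 0" "\<not> (\<forall>\<^sub>F k in sequentially. dist (Y k \<kappa>) (yb \<kappa>) < e)"
      unfolding tendsto_iff by blast
    then have "\<exists>k>n. dist (Y k \<kappa>) (yb \<kappa>) \<ge> e" for n
      unfolding eventually_at_top_dense by (meson not_less)
    then have "infinite {k. dist (Y k \<kappa>) (yb \<kappa>) \<ge> e}"
      by (simp add: infinite_nat_iff_unbounded)
    then obtain s where s: "strict_mono (s :: nat \<Rightarrow> nat)" "\<And>n. dist (Y (s n) \<kappa>) (yb \<kappa>) \<ge> e"
      using infinite_enumerate by blast
    obtain y' q where q: "strict_mono (q :: nat \<Rightarrow> nat)"
      and "\<forall>\<kappa>\<in>K. (\<lambda>k. Y (s (q k)) \<kappa>) \<longlonglongrightarrow> y' \<kappa>"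
      using convergent_subsequence_finite[of K "\<lambda>k. Y (s k)" B] finite_K B by blast
    then have q2: "(\<lambda>k. Y (s (q k)) \<kappa>) \<longlonglongrightarrow> y' \<kappa>" if "\<kappa> \<in> K" for \<kappa>
      using that by blast
    have sq: "strict_mono (\<lambda>k. s (q k))" using s(1) q by (simp add: strict_mono_def)
    have "yb \<kappa> = y' \<kappa>"
      using cluster_points_agree[OF yb cluster_point_multiplier[OF assms sq q2] r r2 sq q2 that] by simp
    then have "(\<lambda>k. dist (Y (s (q k)) \<kappa>) (yb \<kappa>)) \<longlonglongrightarrow> dist (yb \<kappa>) (yb \<kappa>)"
      using q2[OF that] by (intro tendsto_intros) auto
    then have "(\<lambda>k. dist (Y (s (q k)) \<kappa>) (yb \<kappa>)) \<longlonglongrightarrow> 0" by simp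
    then have "e \<le> 0" using s(2) by (intro LIMSEQ_le_const) auto
    with e(1) show False by simp
  qed
  with yb show ?thesis by blast
qed

end


section \<open>Affine, convex and closed conditions on coordinate vectors\<close>

text \<open>
  Points of the coordinate space are plain functions; \<open>mix s u v\<close> is the point that divides the segment
  from \<open>u\<close> to \<open>v\<close> in the ratio \<open>s : 1 - s\<close>. Coordinate names may range over an infinite type, but each
  constraint and cost reads finitely many of them, so pointwise limits of sequences serve as the topology.
\<close>

definition mix :: "real \<Rightarrow> ('c \<Rightarrow> real) \<Rightarrow> ('c \<Rightarrow> real) \<Rightarrow> 'c \<Rightarrow> real" where
  "mix s u v = (\<lambda>c. (1 - s) * u c + s * v c)"

definition seq_continuous :: "(('c \<Rightarrow> real) \<Rightarrow> real) \<Rightarrow> bool" where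
  "seq_continuous f \<longleftrightarrow>
     (\<forall>X l. (\<forall>c. (\<lambda>k::nat. X k c) \<longlonglongrightarrow> l c) \<longrightarrow> (\<lambda>k. f (X k)) \<longlonglongrightarrow> f l)"

text \<open>
  Continuity is part of the next three notions because the same syntactic decomposition of a constraint
  or cost proves convexity and continuity simultaneously.
\<close>

definition affine_fun :: "(('c \<Rightarrow> real) \<Rightarrow> real) \<Rightarrow> bool" where
  "affine_fun f \<longleftrightarrow>
     (\<forall>s u v. f (mix s u v) = (1 - s) * f u + s * f v) \<and> seq_continuous f"

definition convex_fun :: "(('c \<Rightarrow> real) \<Rightarrow> real) \<Rightarrow> bool" where
  "convex_fun f \<longleftrightarrow>
     (\<forall>s u v. 0 \<le> s \<and> s \<le> 1 \<longrightarrow> f (mix s u v) \<le> (1 - s) * f u + s * f v) \<and> seq_continuous f"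

definition closed_convex :: "(('c \<Rightarrow> real) \<Rightarrow> bool) \<Rightarrow> bool" where
  "closed_convex Q \<longleftrightarrow>
     (\<forall>s u v. 0 \<le> s \<and> s \<le> 1 \<and> Q u \<and> Q v \<longrightarrow> Q (mix s u v)) \<and>
     (\<forall>X l. (\<forall>c. (\<lambda>k::nat. X k c) \<longlonglongrightarrow> l c) \<and> (\<forall>k. Q (X k)) \<longrightarrow> Q l)"

lemma affine_coord: "affine_fun (\<lambda>v. v c)"
  by (simp add: affine_fun_def mix_def seq_continuous_def)

lemma affine_const: "affine_fun (\<lambda>v. r)"
  by (simp add: affine_fun_def seq_continuous_def algebra_simps)

lemma affine_add: "affine_fun f \<Longrightarrow> affine_fun g \<Longrightarrow> affine_fun (\<lambda>v. f v + g v)"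
  unfolding affine_fun_def seq_continuous_def by (auto simp: algebra_simps intro!: tendsto_add)

lemma affine_diff: "affine_fun f \<Longrightarrow> affine_fun g \<Longrightarrow> affine_fun (\<lambda>v. f v - g v)"
  unfolding affine_fun_def seq_continuous_def by (auto simp: algebra_simps intro!: tendsto_diff)

lemma affine_scale: "affine_fun f \<Longrightarrow> affine_fun (\<lambda>v. r * f v)"
  unfolding affine_fun_def seq_continuous_def
  by (auto simp: distrib_left mult.left_commute intro!: tendsto_mult_left)

lemma affine_sum:
  assumes "\<And>i. i \<in> I \<Longrightarrow> affine_fun (f i)"
  shows "affine_fun (\<lambda>v. \<Sum>i\<in>I. f i v)"
  using assms unfolding affine_fun_def seq_continuous_def
  by (auto simp: sum.distrib sum_distrib_left intro!: tendsto_sum)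

lemma affine_scale_right: "affine_fun f \<Longrightarrow> affine_fun (\<lambda>v. f v * r)"
  using affine_scale[of f r] by (simp add: mult.commute)

lemma affine_divide: "affine_fun f \<Longrightarrow> affine_fun (\<lambda>v. f v / r)"
  using affine_scale[of f "1 / r"] by simp

lemma affine_minus: "affine_fun f \<Longrightarrow> affine_fun (\<lambda>v. - f v)"
  using affine_scale[of f "- 1"] by simp

lemmas affine_intros = affine_coord affine_const affine_add affine_diff affine_minus affine_scale
  affine_scale_right affine_divide affine_sum

lemma closed_convexI:
  assumes "\<And>s u v. 0 \<le> s \<Longrightarrow> s \<le> 1 \<Longrightarrow> Q u \<Longrightarrow> Q v \<Longrightarrow> Q (mix s u v)"
    and "\<And>X l. (\<And>c. (\<lambda>k. X k c) \<longlonglongrightarrow> l c) \<Longrightarrow> (\<And>k. Q (X k)) \<Longrightarrow> Q l"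
  shows "closed_convex Q"
  using assms unfolding closed_convex_def by blast

lemma closed_convex_mix: "closed_convex Q \<Longrightarrow> 0 \<le> s \<Longrightarrow> s \<le> 1 \<Longrightarrow> Q u \<Longrightarrow> Q v \<Longrightarrow> Q (mix s u v)"
  by (simp add: closed_convex_def)

lemma closed_convex_limit:
  "closed_convex Q \<Longrightarrow> (\<And>c. (\<lambda>k. X k c) \<longlonglongrightarrow> l c) \<Longrightarrow> (\<And>k. Q (X k)) \<Longrightarrow> Q l"
  unfolding closed_convex_def by blast

lemma affine_mix: "affine_fun f \<Longrightarrow> f (mix s u v) = (1 - s) * f u + s * f v"
  by (simp add: affine_fun_def)

lemma affine_limit: "affine_fun f \<Longrightarrow> (\<And>c. (\<lambda>k. X k c) \<longlonglongrightarrow> l c) \<Longrightarrow> (\<lambda>k. f (X k)) \<longlonglongrightarrow> f l"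
  by (simp add: affine_fun_def seq_continuous_def)

lemma closed_convex_le:
  assumes "affine_fun f" "affine_fun g"
  shows "closed_convex (\<lambda>v. f v \<le> g v)"
proof (rule closed_convexI)
  show "f (mix s u v) \<le> g (mix s u v)" if "0 \<le> s" "s \<le> 1" "f u \<le> g u" "f v \<le> g v" for s u v
    using that by (simp add: affine_mix[OF assms(1)] affine_mix[OF assms(2)] add_mono mult_left_mono)
  show "f l \<le> g l" if "\<And>c. (\<lambda>k. X k c) \<longlonglongrightarrow> l c" "\<And>k. f (X k) \<le> g (X k)" for X l
    by (rule LIMSEQ_le[OF affine_limit[OF assms(1) that(1)] affine_limit[OF assms(2) that(1)]])
      (use that(2) in auto)
qed

lemma closed_convex_conj:
  assumes "closed_convex P" "closed_convex Q"
  shows "closed_convex (\<lambda>v. P v \<and> Q v)"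
  using closed_convex_mix[OF assms(1)] closed_convex_mix[OF assms(2)]
    closed_convex_limit[OF assms(1)] closed_convex_limit[OF assms(2)]
  by (intro closed_convexI) blast+

lemma closed_convex_eq: "affine_fun f \<Longrightarrow> affine_fun g \<Longrightarrow> closed_convex (\<lambda>v. f v = g v)"
  unfolding order.eq_iff by (intro closed_convex_conj closed_convex_le)

lemma closed_convex_ball:
  assumes "\<And>i. i \<in> I \<Longrightarrow> closed_convex (P i)"
  shows "closed_convex (\<lambda>v. \<forall>i\<in>I. P i v)"
  using closed_convex_mix[OF assms] closed_convex_limit[OF assms]
  by (intro closed_convexI) blast+

lemma closed_convex_all:
  assumes "\<And>i. closed_convex (P i)"
  shows "closed_convex (\<lambda>v. \<forall>i. P i v)"
  using closed_convex_ball[of UNIV P] assms by simp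

lemma closed_convex_imp:
  assumes "C \<Longrightarrow> closed_convex P"
  shows "closed_convex (\<lambda>v. C \<longrightarrow> P v)"
proof (cases C)
  case True
  with assms show ?thesis by simp
qed (simp add: closed_convex_def)

lemmas closed_convex_intros = closed_convex_conj closed_convex_all closed_convex_ball closed_convex_imp
  closed_convex_le closed_convex_eq affine_intros

lemma affine_imp_convex: "affine_fun f \<Longrightarrow> convex_fun f"
  by (simp add: affine_fun_def convex_fun_def)

lemma convex_fun_limit:
  "convex_fun f \<Longrightarrow> (\<And>c. (\<lambda>k. X k c) \<longlonglongrightarrow> l c) \<Longrightarrow> (\<lambda>k. f (X k)) \<longlonglongrightarrow> f l"
  by (simp add: convex_fun_def seq_continuous_def)

lemma convex_fun_add:
  assumes "convex_fun f" "convex_fun g"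
  shows "convex_fun (\<lambda>v. f v + g v)"
proof -
  have "f (mix s u v) + g (mix s u v) \<le> (1 - s) * (f u + g u) + s * (f v + g v)"
    if "0 \<le> s" "s \<le> 1" for s u v
  proof -
    have "f (mix s u v) \<le> (1 - s) * f u + s * f v" "g (mix s u v) \<le> (1 - s) * g u + s * g v"
      using assms that by (auto simp: convex_fun_def)
    then show ?thesis by (simp add: algebra_simps)
  qed
  then show ?thesis
    using assms unfolding convex_fun_def seq_continuous_def by (auto intro!: tendsto_add)
qed

lemma convex_fun_sum:
  assumes "\<And>i. i \<in> I \<Longrightarrow> convex_fun (f i)"
  shows "convex_fun (\<lambda>v. \<Sum>i\<in>I. f i v)"
proof (cases "finite I")
  case True
  then show ?thesis using assms
    by (induction I) (auto intro: convex_fun_add affine_imp_convex affine_const)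
qed (simp add: affine_imp_convex affine_const)

lemma convex_fun_scale:
  assumes "0 \<le> r" "convex_fun f"
  shows "convex_fun (\<lambda>v. r * f v)"
proof -
  have "r * f (mix s u v) \<le> (1 - s) * (r * f u) + s * (r * f v)" if "0 \<le> s" "s \<le> 1" for s u v
    using mult_left_mono[of "f (mix s u v)" "(1 - s) * f u + s * f v" r] assms that
    by (simp add: convex_fun_def algebra_simps)
  then show ?thesis
    using assms unfolding convex_fun_def seq_continuous_def by (auto intro!: tendsto_mult_left)
qed

lemma convex_fun_square:
  assumes "affine_fun f"
  shows "convex_fun (\<lambda>v. (f v)\<^sup>2)"
proof -
  have "((1 - s) * a + s * b)\<^sup>2 \<le> (1 - s) * a\<^sup>2 + s * b\<^sup>2" if "0 \<le> s" "s \<le> 1" for s a b :: real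
  proof -
    have "(1 - s) * a\<^sup>2 + s * b\<^sup>2 - ((1 - s) * a + s * b)\<^sup>2 = s * (1 - s) * (a - b)\<^sup>2"
      by (simp add: power2_eq_square algebra_simps)
    moreover have "s * (1 - s) * (a - b)\<^sup>2 \<ge> 0" using that by simp
    ultimately show ?thesis by linarith
  qed
  then show ?thesis
    using assms unfolding convex_fun_def affine_fun_def seq_continuous_def
    by (auto intro!: tendsto_power)
qed

lemma convex_fun_if:
  assumes "C \<Longrightarrow> convex_fun f" "\<not> C \<Longrightarrow> convex_fun g"
  shows "convex_fun (\<lambda>v. if C then f v else g v)"
  using assms by (cases C) auto

text \<open>
  Every constraint is an affine equation or inequality, absolute values being pairs of inequalities.
\<close>

lemma closed_convex_local_set: "closed_convex (\<lambda>v. v \<in> local_set D i)"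
  unfolding local_set_def area_space_def mem_Collect_eq reg_con_def balance_con_def flow_con_def
    loss_con_def unit_con_def nonanticip_con_def battery_con_def converter_con_def peak_con_def
    delivery_con_def res_con_def abs_le_iff
  by (intro closed_convex_intros)

text \<open>
  The signed energy prices enter linearly, and every square carries a nonnegative coefficient,
  weighted by probabilities.
\<close>

lemma convex_area_cost:
  assumes "standing_conditions D" "i \<in> areas D"
  shows "convex_fun (area_cost D i)"
proof -
  have units: "units_at D i \<subseteq> gen_units D" by (auto simp: units_at_def)
  have "convex_fun (\<lambda>v. stage_cost D i v t m)" if "t \<in> stages D" for t m
    unfolding stage_cost_def Delta_ID_def
    by (intro convex_fun_add convex_fun_if convex_fun_scale convex_fun_sum convex_fun_square
        affine_imp_convex affine_intros)
      (use assms units that in \<open>auto simp: standing_conditions_def\<close>)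
  then have "convex_fun (\<lambda>v. area_cost D i v)"
    unfolding area_cost_def L2_set_def
    by (simp only: real_sqrt_pow2 sum_nonneg zero_le_power2,
        intro convex_fun_add convex_fun_if convex_fun_scale convex_fun_sum convex_fun_square)
      (use assms in \<open>auto simp: standing_conditions_def less_imp_le
         intro!: affine_imp_convex affine_intros convex_fun_sum\<close>)
  then show ?thesis .
qed

text \<open>
  The penalty is differentiable and the rest of the objective is convex, so at a minimizer the
  penalty may be replaced by its linearization, that is, by the updated multiplier. The proof compares
  the minimizer with points of the segment towards the competitor: there the quadratic remainder
  is of second order.
\<close>

lemma augmented_minimizer_linearized:
  assumes f: "convex_fun f" and Q: "closed_convex Q"
    and u: "Q u" and v: "Q v"
    and g: "\<And>\<kappa>. \<kappa> \<in> K \<Longrightarrow> affine_fun (g \<kappa>)"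
    and min: "\<And>w. Q w \<Longrightarrow>
       f u + (\<Sum>\<kappa>\<in>K. y \<kappa> * (g \<kappa> u - z \<kappa>) + \<rho> / 2 * (g \<kappa> u - z \<kappa>)\<^sup>2)
       \<le> f w + (\<Sum>\<kappa>\<in>K. y \<kappa> * (g \<kappa> w - z \<kappa>) + \<rho> / 2 * (g \<kappa> w - z \<kappa>)\<^sup>2)"
  shows "f u + (\<Sum>\<kappa>\<in>K. (y \<kappa> + \<rho> * (g \<kappa> u - z \<kappa>)) * g \<kappa> u)
    \<le> f v + (\<Sum>\<kappa>\<in>K. (y \<kappa> + \<rho> * (g \<kappa> u - z \<kappa>)) * g \<kappa> v)"
proof -
  let ?lin = "\<Sum>\<kappa>\<in>K. (y \<kappa> + \<rho> * (g \<kappa> u - z \<kappa>)) * (g \<kappa> v - g \<kappa> u)"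
  let ?q = "\<Sum>\<kappa>\<in>K. \<rho> / 2 * (g \<kappa> v - g \<kappa> u)\<^sup>2"
  \<comment> \<open>The increment of the objective at \<open>mix s u v\<close>, divided by \<open>s\<close>.\<close>
  have pos: "0 \<le> f v - f u + ?lin + s * ?q" if s: "0 < s" "s \<le> 1" for s
  proof -
    have Qm: "Q (mix s u v)" using Q u v s by (auto simp: closed_convex_def)
    have fm: "f (mix s u v) \<le> f u + s * (f v - f u)"
      using f s by (auto simp: convex_fun_def algebra_simps)
    have gm: "g \<kappa> (mix s u v) = g \<kappa> u + s * (g \<kappa> v - g \<kappa> u)" if "\<kappa> \<in> K" for \<kappa>
      using g[OF that] by (auto simp: affine_fun_def algebra_simps)
    have "(\<Sum>\<kappa>\<in>K. y \<kappa> * (g \<kappa> (mix s u v) - z \<kappa>) + \<rho> / 2 * (g \<kappa> (mix s u v) - z \<kappa>)\<^sup>2)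
      = (\<Sum>\<kappa>\<in>K. y \<kappa> * (g \<kappa> u - z \<kappa>) + \<rho> / 2 * (g \<kappa> u - z \<kappa>)\<^sup>2) + s * ?lin + s\<^sup>2 * ?q"
      unfolding sum_distrib_left sum.distrib[symmetric]
      by (intro sum.cong refl) (simp add: gm power2_eq_square field_simps)
    with min[OF Qm] fm have "0 \<le> s * (f v - f u) + s * ?lin + s\<^sup>2 * ?q" by linarith
    then have "0 \<le> s * (f v - f u + ?lin + s * ?q)" by (simp add: algebra_simps power2_eq_square)
    then show ?thesis using s by (simp add: zero_le_mult_iff)
  qed
  have le: "0 \<le> f v - f u + ?lin + 1 / real (Suc n) * ?q" for n :: nat
    by (rule pos) simp_all
  have "(\<lambda>n. f v - f u + ?lin + 1 / real (Suc n) * ?q) \<longlonglongrightarrow> f v - f u + ?lin + 0 * ?q"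
    by (intro tendsto_add tendsto_mult tendsto_const LIMSEQ_Suc[OF lim_1_over_n])
  then have "0 \<le> f v - f u + ?lin + 0 * ?q"
    by (rule LIMSEQ_le_const) (use le in blast)
  then have "0 \<le> f v - f u + ?lin" by (simp only: mult_zero_left add_0_right)
  moreover have "?lin = (\<Sum>\<kappa>\<in>K. (y \<kappa> + \<rho> * (g \<kappa> u - z \<kappa>)) * g \<kappa> v)
      - (\<Sum>\<kappa>\<in>K. (y \<kappa> + \<rho> * (g \<kappa> u - z \<kappa>)) * g \<kappa> u)"
    by (simp add: sum_subtractf[symmetric] right_diff_distrib)
  ultimately show ?thesis by linarith
qed


section \<open>The copies of the angles and the Lagrangian\<close>

text \<open>
  Copies, consensus values and multipliers are flattened to functions of the triple (holding area,
  area whose angle is copied, slot), so that the coupling term of the Lagrangian is one inner product.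
\<close>

definition copy_index :: "('g, 'h) id_data \<Rightarrow> (nat \<times> nat \<times> nat \<times> nat) set" where
  "copy_index D = (SIGMA i:areas D. hood D i \<times> slots D)"

definition copies :: "(nat \<Rightarrow> 'g coord \<Rightarrow> real) \<Rightarrow> nat \<times> nat \<times> nat \<times> nat \<Rightarrow> real" where
  "copies x = (\<lambda>(i, a, \<tau>). sel a (x i) \<tau>)"

definition spread :: "(nat \<Rightarrow> block) \<Rightarrow> nat \<times> nat \<times> nat \<times> nat \<Rightarrow> real" where
  "spread z = (\<lambda>(i, a, \<tau>). z a \<tau>)"

definition stack :: "(nat \<Rightarrow> nat \<Rightarrow> block) \<Rightarrow> nat \<times> nat \<times> nat \<times> nat \<Rightarrow> real" where
  "stack y = (\<lambda>(i, a, \<tau>). y i a \<tau>)"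

lemma finite_areas: "finite (areas D)"
  and finite_slots: "finite (slots D)"
  by (simp_all add: areas_def slots_def stages_def scens_def)

lemma hood_subset_areas: "id_model D \<Longrightarrow> i \<in> areas D \<Longrightarrow> hood D i \<subseteq> areas D"
  by (auto simp: id_model_def hood_def nbrs_def)

lemma finite_hood: "id_model D \<Longrightarrow> i \<in> areas D \<Longrightarrow> finite (hood D i)"
  using hood_subset_areas finite_areas finite_subset by metis

lemma hood_sym: "a \<in> hood D i \<longleftrightarrow> i \<in> hood D a"
  by (auto simp: hood_def nbrs_def)

lemma card_hood:
  assumes "id_model D" "i \<in> areas D"
  shows "card (hood D i) = Suc (card (nbrs D i))"
proof -
  have "finite (nbrs D i)" using finite_hood[OF assms] by (simp add: hood_def)
  moreover have "i \<notin> nbrs D i" using assms(1) by (auto simp: id_model_def nbrs_def)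
  ultimately show ?thesis by (simp add: hood_def)
qed

lemma finite_copy_index: "id_model D \<Longrightarrow> finite (copy_index D)"
  unfolding copy_index_def using finite_areas finite_hood finite_slots by (intro finite_SigmaI) auto

lemma dot_copy_index:
  assumes "id_model D"
  shows "dot (copy_index D) u v
    = (\<Sum>i\<in>areas D. \<Sum>a\<in>hood D i. \<Sum>\<tau>\<in>slots D. u (i, a, \<tau>) * v (i, a, \<tau>))"
proof -
  have "dot (copy_index D) u v = (\<Sum>i\<in>areas D. \<Sum>(a, \<tau>)\<in>hood D i \<times> slots D. u (i, a, \<tau>) * v (i, a, \<tau>))"
    unfolding dot_def copy_index_def using finite_areas finite_hood[OF assms] finite_slots
    by (subst sum.Sigma) (auto intro!: sum.cong)
  then show ?thesis by (simp add: sum.cartesian_product)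
qed

lemma lagrangian_eq_dot:
  assumes "id_model D"
  shows "lagrangian D x z y
    = total_cost D x + dot (copy_index D) (stack y) (\<lambda>\<kappa>. copies x \<kappa> - spread z \<kappa>)"
  by (simp add: lagrangian_def total_cost_def dot_copy_index[OF assms] sum.distrib copies_def spread_def stack_def)

lemma lagrangian_feasible:
  assumes "id_feasible D x z"
  shows "lagrangian D x z y = total_cost D x"
  using assms by (simp add: lagrangian_def total_cost_def id_feasible_def)

lemma feasible_in_lagr_domain: "id_feasible D x z \<Longrightarrow> (x, z) \<in> lagr_domain D"
  by (simp add: id_feasible_def lagr_domain_def)

text \<open>
  Maximality in the multiplier forces consensus: moving the multiplier along the residual raises
  the Lagrangian by the squared norm of the residual.
\<close>

lemma saddle_point_feasible:
  assumes "id_model D" "saddle_point D xs zs ys"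
  shows "id_feasible D xs zs"
proof -
  let ?d = "\<lambda>\<kappa>. copies xs \<kappa> - spread zs \<kappa>"
  let ?y = "\<lambda>i a \<tau>. ys i a \<tau> + ?d (i, a, \<tau>)"
  have "lagrangian D xs zs ?y \<le> lagrangian D xs zs ys"
    using assms(2) unfolding saddle_point_def by blast
  moreover have "stack ?y = (\<lambda>\<kappa>. stack ys \<kappa> + ?d \<kappa>)"
    by (auto simp: stack_def)
  ultimately have "dot (copy_index D) ?d ?d \<le> 0"
    by (simp add: lagrangian_eq_dot[OF assms(1)] dot_add_left)
  then have "(?d \<kappa>)\<^sup>2 \<le> 0" if "\<kappa> \<in> copy_index D" for \<kappa>
    using square_le_dot_self[OF finite_copy_index[OF assms(1)] that, of ?d] by linarith
  then have d0: "?d \<kappa> = 0" if "\<kappa> \<in> copy_index D" for \<kappa>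
    using that by simp
  have "sel a (xs i) \<tau> = zs a \<tau>" if "i \<in> areas D" "a \<in> hood D i" "\<tau> \<in> slots D" for i a \<tau>
    using d0[of "(i, a, \<tau>)"] that by (simp add: copy_index_def copies_def spread_def)
  then show ?thesis
    using assms(2) by (auto simp: saddle_point_def lagr_domain_def id_feasible_def)
qed

lemma saddle_point_le:
  assumes "id_model D" "saddle_point D xs zs ys" "(x, z) \<in> lagr_domain D"
  shows "total_cost D xs \<le> lagrangian D x z ys"
proof -
  have "lagrangian D xs zs ys \<le> lagrangian D x z ys"
    using assms(2,3) unfolding saddle_point_def by blast
  then show ?thesis by (simp only: lagrangian_feasible[OF saddle_point_feasible[OF assms(1,2)]])
qed

lemma saddle_point_value:
  assumes "id_model D" "saddle_point D xs zs ys"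
  shows "id_value D = ereal (total_cost D xs)"
proof (rule antisym)
  show "id_value D \<le> ereal (total_cost D xs)"
    unfolding id_value_def using saddle_point_feasible[OF assms] by (auto intro: INF_lower2)
  show "ereal (total_cost D xs) \<le> id_value D"
    unfolding id_value_def
  proof (rule INF_greatest, clarify)
    fix x z assume "id_feasible D x z"
    then show "ereal (total_cost D xs) \<le> ereal (total_cost D x)"
      using saddle_point_le[OF assms feasible_in_lagr_domain, of x z] by (simp add: lagrangian_feasible)
  qed
qed

lemma id_value_le: "id_value D = ereal J \<Longrightarrow> id_feasible D x z \<Longrightarrow> J \<le> total_cost D x"
  unfolding id_value_def using INF_lower[of "(x, z)" "{(x, z). id_feasible D x z}" "\<lambda>(x, z). ereal (total_cost D x)"]
  by simp

lemma id_optimalI: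
  assumes "id_value D = ereal J" "id_feasible D x z" "total_cost D x = J"
  shows "id_optimal D x z"
  unfolding id_optimal_def is_arg_min_def using assms id_value_le[OF assms(1)] by (auto simp: not_less)

text \<open>
  Weak duality: the Lagrangian of a feasible point is its cost, whatever the multiplier.
\<close>

lemma dual_solutionI:
  assumes "id_feasible D x z"
    and "\<And>x' z'. (x', z') \<in> lagr_domain D \<Longrightarrow> total_cost D x \<le> lagrangian D x' z' y"
  shows "dual_solution D y"
proof -
  have "dual_function D y' \<le> ereal (total_cost D x)" for y'
    unfolding dual_function_def
    using INF_lower[OF feasible_in_lagr_domain[OF assms(1)], of "\<lambda>(x, z). ereal (lagrangian D x z y')"]
    by (simp add: lagrangian_feasible[OF assms(1)])
  moreover have "ereal (total_cost D x) \<le> dual_function D y"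
    unfolding dual_function_def using assms(2) by (intro INF_greatest) auto
  ultimately have "dual_function D y' \<le> dual_function D y" for y'
    using order_trans by blast
  then show ?thesis
    unfolding dual_solution_def is_arg_max_def by (auto simp: not_less)
qed

text \<open>
  Summing first over the holders of a copy, every area other than the reference contributes the sum of
  its multipliers, and the reference contributes the angle zero.
\<close>

lemma dot_stack_spread_eq_0:
  assumes "id_model D"
    and y: "\<And>a \<tau>. a \<in> areas D - {ref_area D} \<Longrightarrow> \<tau> \<in> slots D \<Longrightarrow> (\<Sum>i\<in>hood D a. y i a \<tau>) = 0"
    and z: "\<And>\<tau>. \<tau> \<in> slots D \<Longrightarrow> z (ref_area D) \<tau> = 0"
  shows "dot (copy_index D) (stack y) (spread z) = 0"
proof -
  have h: "hood D i = {a. a \<in> areas D \<and> a \<in> hood D i}" if "i \<in> areas D" for i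
    using hood_subset_areas[OF assms(1) that] by auto
  have h': "hood D a = {i. i \<in> areas D \<and> a \<in> hood D i}" if "a \<in> areas D" for a
    using hood_subset_areas[OF assms(1) that] hood_sym[of a D] by auto
  have "dot (copy_index D) (stack y) (spread z)
      = (\<Sum>i\<in>areas D. \<Sum>a | a \<in> areas D \<and> a \<in> hood D i. \<Sum>\<tau>\<in>slots D. y i a \<tau> * z a \<tau>)"
    unfolding dot_copy_index[OF assms(1)] stack_def spread_def
    by (intro sum.cong) (use h in auto)
  also have "\<dots> = (\<Sum>a\<in>areas D. \<Sum>i | i \<in> areas D \<and> a \<in> hood D i. \<Sum>\<tau>\<in>slots D. y i a \<tau> * z a \<tau>)"
    by (rule sum.swap_restrict) (rule finite_areas)+
  also have "\<dots> = (\<Sum>a\<in>areas D. \<Sum>i\<in>hood D a. \<Sum>\<tau>\<in>slots D. y i a \<tau> * z a \<tau>)"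
    by (intro sum.cong) (use h' in auto)
  also have "\<dots> = (\<Sum>a\<in>areas D. \<Sum>\<tau>\<in>slots D. (\<Sum>i\<in>hood D a. y i a \<tau>) * z a \<tau>)"
    by (intro sum.cong refl) (subst sum.swap, simp add: sum_distrib_right)
  also have "\<dots> = 0"
  proof (intro sum.neutral ballI)
    fix a \<tau> assume "a \<in> areas D" "\<tau> \<in> slots D"
    then show "(\<Sum>i\<in>hood D a. y i a \<tau>) * z a \<tau> = 0"
      using y[of a \<tau>] z[of \<tau>] by (cases "a = ref_area D") auto
  qed
  finally show ?thesis .
qed


section \<open>The iteration as a consensus ADMM\<close>

text \<open>
  The z-update chooses the average for which the multipliers updated next cancel; this uses that
  the number of holders is one more than the number of neighbours.
\<close>

lemma admm_multiplier_sum_zero: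
  assumes "id_model D" "\<rho> > 0" "admm_iterates D \<rho> x z y"
    and "a \<in> areas D - {ref_area D}" "\<tau> \<in> slots D"
  shows "(\<Sum>i\<in>hood D a. y (Suc k) i a \<tau>) = 0"
proof -
  have a: "a \<in> areas D" using assms(4) by simp
  let ?s = "\<Sum>i\<in>hood D a. sel a (x (Suc k) i) \<tau> + 1 / \<rho> * y k i a \<tau>"
  have z: "z (Suc k) a \<tau> = 1 / (1 + real (card (nbrs D a))) * ?s"
    using assms(3-5) unfolding admm_iterates_def by blast
  have "y (Suc k) i a \<tau> = y k i a \<tau> + \<rho> * (sel a (x (Suc k) i) \<tau> - z (Suc k) a \<tau>)" if "i \<in> hood D a" for i
  proof -
    have "i \<in> areas D" using that hood_subset_areas[OF assms(1) a] by blast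
    moreover have "a \<in> hood D i" using that by (simp add: hood_sym[of a])
    ultimately show ?thesis using assms(3,5) unfolding admm_iterates_def by blast
  qed
  then have "(\<Sum>i\<in>hood D a. y (Suc k) i a \<tau>)
      = (\<Sum>i\<in>hood D a. \<rho> * (sel a (x (Suc k) i) \<tau> + 1 / \<rho> * y k i a \<tau>) - \<rho> * z (Suc k) a \<tau>)"
    using assms(2) by (intro sum.cong refl) (simp add: algebra_simps)
  also have "\<dots> = \<rho> * ?s - real (card (hood D a)) * (\<rho> * z (Suc k) a \<tau>)"
    by (simp add: sum_subtractf sum_distrib_left)
  also have "\<dots> = 0"
    unfolding z card_hood[OF assms(1) a] by (simp add: field_simps)
  finally show ?thesis .
qed

text \<open>
  The factor in front of the copies is the next multiplier corrected by the change of the consensus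
  value; it is written here in terms of the old quantities.
\<close>

lemma admm_area_step:
  assumes "standing_conditions D" "i \<in> areas D"
    and "is_arg_min (x_objective D \<rho> i z y) (\<lambda>v. v \<in> local_set D i) u"
    and "v \<in> local_set D i"
  shows "area_cost D i u
      + (\<Sum>a\<in>hood D i. \<Sum>\<tau>\<in>slots D. (y i a \<tau> + \<rho> * (sel a u \<tau> - z a \<tau>)) * sel a u \<tau>)
    \<le> area_cost D i v
      + (\<Sum>a\<in>hood D i. \<Sum>\<tau>\<in>slots D. (y i a \<tau> + \<rho> * (sel a u \<tau> - z a \<tau>)) * sel a v \<tau>)"
proof -
  let ?g = "\<lambda>(a, \<tau>) v. sel a v \<tau>" and ?K = "hood D i \<times> slots D"
  let ?y = "\<lambda>(a, \<tau>). y i a \<tau>" and ?z = "\<lambda>(a, \<tau>). z a \<tau>"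
  have obj: "x_objective D \<rho> i z y w = area_cost D i w
      + (\<Sum>\<kappa>\<in>?K. ?y \<kappa> * (?g \<kappa> w - ?z \<kappa>) + \<rho> / 2 * (?g \<kappa> w - ?z \<kappa>)\<^sup>2)" for w
  proof -
    have "(\<Sum>a\<in>hood D i. (\<Sum>\<tau>\<in>slots D. y i a \<tau> * (sel a w \<tau> - z a \<tau>))
        + \<rho> / 2 * (L2_set (\<lambda>\<tau>. sel a w \<tau> - z a \<tau>) (slots D))\<^sup>2)
      = (\<Sum>a\<in>hood D i. \<Sum>\<tau>\<in>slots D. y i a \<tau> * (sel a w \<tau> - z a \<tau>) + \<rho> / 2 * (sel a w \<tau> - z a \<tau>)\<^sup>2)"
      by (simp add: L2_set_def sum_nonneg sum.distrib sum_distrib_left)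
    then show ?thesis
      by (simp add: x_objective_def sum.cartesian_product case_prod_beta)
  qed
  have "area_cost D i u + (\<Sum>\<kappa>\<in>?K. (?y \<kappa> + \<rho> * (?g \<kappa> u - ?z \<kappa>)) * ?g \<kappa> u)
      \<le> area_cost D i v + (\<Sum>\<kappa>\<in>?K. (?y \<kappa> + \<rho> * (?g \<kappa> u - ?z \<kappa>)) * ?g \<kappa> v)"
  proof (rule augmented_minimizer_linearized[where f = "area_cost D i" and Q = "\<lambda>v. v \<in> local_set D i"
        and g = ?g and y = ?y and z = ?z and K = ?K])
    show "convex_fun (area_cost D i)" by (rule convex_area_cost[OF assms(1,2)])
    show "closed_convex (\<lambda>v. v \<in> local_set D i)" by (rule closed_convex_local_set)
    show "u \<in> local_set D i" "v \<in> local_set D i" using assms(3,4) by (simp_all add: is_arg_min_def)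
    show "affine_fun (?g \<kappa>)" for \<kappa>
      by (cases \<kappa>) (simp add: sel_def affine_coord)
    show "area_cost D i u + (\<Sum>\<kappa>\<in>?K. ?y \<kappa> * (?g \<kappa> u - ?z \<kappa>) + \<rho> / 2 * (?g \<kappa> u - ?z \<kappa>)\<^sup>2)
      \<le> area_cost D i w + (\<Sum>\<kappa>\<in>?K. ?y \<kappa> * (?g \<kappa> w - ?z \<kappa>) + \<rho> / 2 * (?g \<kappa> w - ?z \<kappa>)\<^sup>2)"
      if "w \<in> local_set D i" for w
      using assms(3) that unfolding obj[symmetric] by (auto simp: is_arg_min_def not_less)
  qed
  then show ?thesis by (simp add: sum.cartesian_product case_prod_beta)
qed

definition attainable :: "('g, 'h) id_data \<Rightarrow> (real \<times> (nat \<times> nat \<times> nat \<times> nat \<Rightarrow> real)) set" where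
  "attainable D = {(total_cost D x, copies x) | x. \<forall>i\<in>areas D. x i \<in> local_set D i}"

text \<open>
  Values off \<open>copy_index D\<close> are left free, because the copies of a feasible point agree with the
  consensus angles only at these indices.
\<close>

definition consensus :: "('g, 'h) id_data \<Rightarrow> (nat \<times> nat \<times> nat \<times> nat \<Rightarrow> real) set" where
  "consensus D = {w. \<exists>z. (\<forall>\<tau>\<in>slots D. z (ref_area D) \<tau> = 0) \<and> (\<forall>\<kappa>\<in>copy_index D. w \<kappa> = spread z \<kappa>)}"

text \<open>
  The index is shifted by one: the initial values are arbitrary, and only from the first update on do
  the reference angle vanish and the multipliers of each angle cancel.
\<close>

lemma admm_iterates_imp_consensus_admm:
  assumes model: "id_model D" and sc: "standing_conditions D" and rho: "\<rho> > 0"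
    and admm: "admm_iterates D \<rho> x z y" and feas: "id_feasible D xs zs"
  shows "consensus_admm (copy_index D) (consensus D) (attainable D) \<rho> (total_cost D xs)
    (\<lambda>k. total_cost D (x (Suc k))) (\<lambda>k. copies (x (Suc k))) (\<lambda>k. spread (z (Suc k)))
    (\<lambda>k. stack (y (Suc k))) (copies xs)"
proof
  show "finite (copy_index D)" by (rule finite_copy_index[OF model])
  show "\<rho> > 0" by (rule rho)
  have ref: "z (Suc k) (ref_area D) \<tau> = 0" if "\<tau> \<in> slots D" for k \<tau>
    using admm that unfolding admm_iterates_def by blast
  show "spread (z (Suc k)) \<in> consensus D" for k
    using ref unfolding consensus_def by blast
  show "dot (copy_index D) (stack (y (Suc k))) w = 0" if w: "w \<in> consensus D" for w k
  proof -
    obtain z' where z': "\<forall>\<tau>\<in>slots D. z' (ref_area D) \<tau> = 0" "\<forall>\<kappa>\<in>copy_index D. w \<kappa> = spread z' \<kappa>"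
      using w unfolding consensus_def by blast
    have "dot (copy_index D) (stack (y (Suc k))) w = dot (copy_index D) (stack (y (Suc k))) (spread z')"
      using z'(2) by (intro dot_cong) auto
    also have "\<dots> = 0"
      using z'(1) admm_multiplier_sum_zero[OF model rho admm]
      by (intro dot_stack_spread_eq_0[OF model]) auto
    finally show ?thesis .
  qed
  have loc: "x (Suc k) i \<in> local_set D i" if "i \<in> areas D" for k i
    using admm that unfolding admm_iterates_def is_arg_min_def by blast
  then show "(total_cost D (x (Suc k)), copies (x (Suc k))) \<in> attainable D" for k
    unfolding attainable_def by blast
  have step: "y (Suc k) i a \<tau> = y k i a \<tau> + \<rho> * (sel a (x (Suc k) i) \<tau> - z (Suc k) a \<tau>)"
    if "i \<in> areas D" "a \<in> hood D i" "\<tau> \<in> slots D" for k i a \<tau>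
    using admm that unfolding admm_iterates_def by blast
  then show "stack (y (Suc (Suc k))) \<kappa> = stack (y (Suc k)) \<kappa>
      + \<rho> * (copies (x (Suc (Suc k))) \<kappa> - spread (z (Suc (Suc k))) \<kappa>)" if "\<kappa> \<in> copy_index D" for \<kappa> k
    using that by (auto simp: copy_index_def stack_def copies_def spread_def)
  show "total_cost D (x (Suc (Suc k))) + dot (copy_index D) (\<lambda>\<kappa>. stack (y (Suc (Suc k))) \<kappa>
        + \<rho> * (spread (z (Suc (Suc k))) \<kappa> - spread (z (Suc k)) \<kappa>)) (copies (x (Suc (Suc k))))
    \<le> c + dot (copy_index D) (\<lambda>\<kappa>. stack (y (Suc (Suc k))) \<kappa>
        + \<rho> * (spread (z (Suc (Suc k))) \<kappa> - spread (z (Suc k)) \<kappa>)) v"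
    if cv: "(c, v) \<in> attainable D" for c v k
  proof -
    obtain x' where x': "c = total_cost D x'" "v = copies x'" "\<forall>i\<in>areas D. x' i \<in> local_set D i"
      using cv unfolding attainable_def by blast
    let ?x = "x (Suc (Suc k))" and ?z = "z (Suc k)" and ?y = "y (Suc k)"
    let ?w = "\<lambda>\<kappa>. stack ?y \<kappa> + \<rho> * (copies ?x \<kappa> - spread ?z \<kappa>)"
    have w: "dot (copy_index D) (\<lambda>\<kappa>. stack (y (Suc (Suc k))) \<kappa>
        + \<rho> * (spread (z (Suc (Suc k))) \<kappa> - spread ?z \<kappa>)) u = dot (copy_index D) ?w u" for u
      by (rule dot_cong)
        (auto simp: copy_index_def stack_def copies_def spread_def step algebra_simps)
    have "total_cost D ?x + dot (copy_index D) ?w (copies ?x)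
        \<le> total_cost D x' + dot (copy_index D) ?w (copies x')"
      unfolding total_cost_def dot_copy_index[OF model] sum.distrib[symmetric]
      unfolding stack_def copies_def spread_def prod.case
    proof (rule sum_mono)
      fix i assume i: "i \<in> areas D"
      have "is_arg_min (x_objective D \<rho> i ?z ?y) (\<lambda>v. v \<in> local_set D i) (?x i)"
        using admm i unfolding admm_iterates_def by blast
      then show "area_cost D i (?x i) + (\<Sum>a\<in>hood D i. \<Sum>\<tau>\<in>slots D.
            (?y i a \<tau> + \<rho> * (sel a (?x i) \<tau> - ?z a \<tau>)) * sel a (?x i) \<tau>)
          \<le> area_cost D i (x' i) + (\<Sum>a\<in>hood D i. \<Sum>\<tau>\<in>slots D.
            (?y i a \<tau> + \<rho> * (sel a (?x i) \<tau> - ?z a \<tau>)) * sel a (x' i) \<tau>)"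
        using x'(3) i by (intro admm_area_step[OF sc i]) auto
    qed
    then show ?thesis by (simp only: w x'(1,2))
  qed
  show "(total_cost D xs, copies xs) \<in> attainable D"
    using feas unfolding attainable_def id_feasible_def by blast
  show "copies xs \<in> consensus D"
  proof -
    have "\<forall>\<kappa>\<in>copy_index D. copies xs \<kappa> = spread zs \<kappa>"
      using feas by (auto simp: copy_index_def copies_def spread_def id_feasible_def)
    then show ?thesis using feas unfolding consensus_def id_feasible_def by blast
  qed
qed

lemma multiplier_iff_lagrangian:
  assumes "id_model D"
    and "consensus_admm (copy_index D) (consensus D) (attainable D) \<rho> J P A U Y Us"
  shows "consensus_admm.multiplier (copy_index D) (consensus D) (attainable D) J (stack ys)
    \<longleftrightarrow> (\<forall>(x, z)\<in>lagr_domain D. J \<le> lagrangian D x z ys)"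
  unfolding consensus_admm.multiplier_def[OF assms(2)]
proof safe
  fix x z
  assume xz: "(x, z) \<in> lagr_domain D"
    and m: "\<forall>(c, v)\<in>attainable D. \<forall>w\<in>consensus D. J \<le> c + dot (copy_index D) (stack ys) (\<lambda>\<kappa>. v \<kappa> - w \<kappa>)"
  have "(total_cost D x, copies x) \<in> attainable D"
    using xz by (auto simp: attainable_def lagr_domain_def)
  moreover have "spread z \<in> consensus D"
    using xz by (auto simp: consensus_def lagr_domain_def)
  ultimately show "J \<le> lagrangian D x z ys"
    using m unfolding lagrangian_eq_dot[OF assms(1)] by blast
next
  fix c v w
  assume m: "\<forall>(x, z)\<in>lagr_domain D. J \<le> lagrangian D x z ys"
    and cv: "(c, v) \<in> attainable D" and w: "w \<in> consensus D"
  obtain x where x: "c = total_cost D x" "v = copies x" "\<forall>i\<in>areas D. x i \<in> local_set D i"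
    using cv unfolding attainable_def by blast
  obtain z where z: "\<forall>\<tau>\<in>slots D. z (ref_area D) \<tau> = 0" "\<forall>\<kappa>\<in>copy_index D. w \<kappa> = spread z \<kappa>"
    using w unfolding consensus_def by blast
  have "dot (copy_index D) (stack ys) (\<lambda>\<kappa>. v \<kappa> - w \<kappa>)
      = dot (copy_index D) (stack ys) (\<lambda>\<kappa>. copies x \<kappa> - spread z \<kappa>)"
    using z(2) x(2) by (intro dot_cong) auto
  moreover have "(x, z) \<in> lagr_domain D" using x(3) z(1) by (simp add: lagr_domain_def)
  ultimately show "J \<le> c + dot (copy_index D) (stack ys) (\<lambda>\<kappa>. v \<kappa> - w \<kappa>)"
    using m unfolding x(1) lagrangian_eq_dot[OF assms(1)] by (metis (no_types, lifting) case_prodD)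
qed


section \<open>Accumulation points and the centralized problem\<close>

text \<open>
  Local sets are closed and costs continuous, the residuals tend to zero, hence a limit is feasible and
  its cost is the limit \<open>J\<close> of the costs.
\<close>

lemma accumulation_point_optimal:
  assumes model: "id_model D" and sc: "standing_conditions D"
    and val: "id_value D = ereal J"
    and loc: "\<And>k i. i \<in> areas D \<Longrightarrow> x (Suc k) i \<in> local_set D i"
    and ref: "\<And>k \<tau>. \<tau> \<in> slots D \<Longrightarrow> z (Suc k) (ref_area D) \<tau> = 0"
    and res: "stacked_tendsto D (\<lambda>k. primal_residual (x k) (z k)) (\<lambda>i a \<tau>. 0)"
    and cost: "(\<lambda>k. total_cost D (x k)) \<longlonglongrightarrow> J"
    and acc: "accumulation_point D x z xb zb"
  shows "id_optimal D xb zb"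
proof -
  obtain \<phi> where phi: "strict_mono \<phi>"
    and xlim: "\<And>i c. i \<in> areas D \<Longrightarrow> c \<in> coords D i \<Longrightarrow> (\<lambda>k. x (\<phi> k) i c) \<longlonglongrightarrow> xb i c"
    and zlim: "\<And>a \<tau>. a \<in> areas D \<Longrightarrow> \<tau> \<in> slots D \<Longrightarrow> (\<lambda>k. z (\<phi> k) a \<tau>) \<longlonglongrightarrow> zb a \<tau>"
    and space: "\<And>i. i \<in> areas D \<Longrightarrow> xb i \<in> area_space D i"
    using acc unfolding accumulation_point_def by blast
  \<comment> \<open>Dropping the first term keeps the subsequence away from the arbitrary initial values.\<close>
  define \<psi> where "\<psi> k = \<phi> (Suc k)" for k
  have psi: "strict_mono \<psi>" using phi by (simp add: strict_mono_def \<psi>_def)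
  have pos: "\<exists>n. \<psi> k = Suc n" for k
    using strict_mono_less[OF phi, of k "Suc k"] unfolding \<psi>_def by (cases "\<phi> (Suc k)") auto
  have locp: "x (\<psi> k) i \<in> local_set D i" if "i \<in> areas D" for k i
    using pos[of k] loc[OF that] by auto
  have xpsi: "(\<lambda>k. x (\<psi> k) i c) \<longlonglongrightarrow> xb i c" if "i \<in> areas D" for i c
  proof (cases "c \<in> coords D i")
    case True
    then show ?thesis using LIMSEQ_Suc[OF xlim[OF that]] by (simp add: \<psi>_def)
  next
    case False
    then have "x (\<psi> k) i c = 0" for k
      using locp[OF that, of k] by (simp add: local_set_def area_space_def)
    moreover have "xb i c = 0" using False space[OF that] by (simp add: area_space_def)
    ultimately show ?thesis by simp
  qed
  have zpsi: "(\<lambda>k. z (\<psi> k) a \<tau>) \<longlonglongrightarrow> zb a \<tau>" if "a \<in> areas D" "\<tau> \<in> slots D" for a \<tau>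
    using LIMSEQ_Suc[OF zlim[OF that]] by (simp add: \<psi>_def)
  have sub: "f \<longlonglongrightarrow> l \<Longrightarrow> (\<lambda>k. f (\<psi> k)) \<longlonglongrightarrow> l" for f :: "nat \<Rightarrow> real" and l
    using LIMSEQ_subseq_LIMSEQ[OF _ psi] by (auto simp: o_def)
  have "xb i \<in> local_set D i" if "i \<in> areas D" for i
    using closed_convex_limit[OF closed_convex_local_set, of "\<lambda>k. x (\<psi> k) i" "xb i" D i] xpsi[OF that] locp[OF that]
    by blast
  moreover have "sel a (xb i) \<tau> = zb a \<tau>" if "i \<in> areas D" "a \<in> hood D i" "\<tau> \<in> slots D" for i a \<tau>
  proof -
    have a: "a \<in> areas D" using hood_subset_areas[OF model that(1)] that(2) by blast
    have "(\<lambda>k. primal_residual (x k) (z k) i a \<tau>) \<longlonglongrightarrow> 0"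
      using res that unfolding stacked_tendsto_def by blast
    then have "(\<lambda>k. sel a (x (\<psi> k) i) \<tau> - z (\<psi> k) a \<tau>) \<longlonglongrightarrow> 0"
      unfolding primal_residual_def by (rule sub)
    moreover have "(\<lambda>k. sel a (x (\<psi> k) i) \<tau> - z (\<psi> k) a \<tau>) \<longlonglongrightarrow> sel a (xb i) \<tau> - zb a \<tau>"
      using xpsi[OF that(1)] zpsi[OF a that(3)]
      by (intro tendsto_diff) (auto simp: sel_def split: prod.split)
    ultimately show ?thesis using LIMSEQ_unique by fastforce
  qed
  moreover have "zb (ref_area D) \<tau> = 0" if "\<tau> \<in> slots D" for \<tau>
  proof (rule LIMSEQ_unique)
    show "(\<lambda>k. z (\<psi> k) (ref_area D) \<tau>) \<longlonglongrightarrow> zb (ref_area D) \<tau>"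
      using model that by (intro zpsi) (auto simp: id_model_def)
    have "z (\<psi> k) (ref_area D) \<tau> = 0" for k using pos[of k] ref[OF that] by auto
    then show "(\<lambda>k. z (\<psi> k) (ref_area D) \<tau>) \<longlonglongrightarrow> 0" by simp
  qed
  ultimately have feas: "id_feasible D xb zb" by (simp add: id_feasible_def)
  have "(\<lambda>k. total_cost D (x (\<psi> k))) \<longlonglongrightarrow> total_cost D xb"
    unfolding total_cost_def
  proof (rule tendsto_sum)
    fix i assume i: "i \<in> areas D"
    show "(\<lambda>k. area_cost D i (x (\<psi> k) i)) \<longlonglongrightarrow> area_cost D i (xb i)"
      by (rule convex_fun_limit[OF convex_area_cost[OF sc i] xpsi[OF i]])
  qed
  then have "total_cost D xb = J" by (rule LIMSEQ_unique[OF _ sub[OF cost]])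
  with val feas show ?thesis by (rule id_optimalI)
qed

lemma line_ends:
  assumes "id_model D" "e \<in> line_set D"
  shows "fst e \<in> areas D" "snd e \<in> areas D" "fst e \<noteq> snd e"
    "e \<in> incident D (fst e)" "e \<in> incident D (snd e)"
    "other_end (fst e) e = snd e" "other_end (snd e) e = fst e"
proof -
  obtain i j where e: "e = (i, j)" by (cases e)
  then have "(i, j) \<in> line_set D" using assms(2) by simp
  moreover from this have "i \<in> areas D" "j \<in> areas D" "i \<noteq> j"
    using assms(1) unfolding id_model_def by blast+
  ultimately show "fst e \<in> areas D" "snd e \<in> areas D" "fst e \<noteq> snd e"
    "e \<in> incident D (fst e)" "e \<in> incident D (snd e)"
    "other_end (fst e) e = snd e" "other_end (snd e) e = fst e"
    by (simp_all add: e incident_def other_end_def)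
qed

text \<open>
  The two orientations cancel: the sign of the flow copy and the order in which the end areas subtract
  their angles change together, so both holders of a line compute the same flow.
\<close>

lemma flow_of_angles:
  assumes "id_model D" "id_feasible D x z" "i \<in> areas D" "e \<in> incident D i" "(t, m) \<in> slots D"
  shows "x i (Flow e t m) = suscept D e * (z (fst e) (t, m) - z (snd e) (t, m))"
proof -
  have e: "e \<in> line_set D" "fst e = i \<or> snd e = i" using assms(4) by (auto simp: incident_def)
  have hood: "fst e \<in> hood D i" "snd e \<in> hood D i"
    using e by (cases e; auto simp: hood_def nbrs_def)+
  have angle: "x i (Angle a t m) = z a (t, m)" if "a \<in> hood D i" for a
    using assms(2,3,5) that unfolding id_feasible_def sel_def by fastforce
  have "flow_con D i (x i)" using assms(2,3) by (auto simp: id_feasible_def local_set_def)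
  then have "x i (Flow e t m)
      = orient i e * suscept D e * (x i (Angle i t m) - x i (Angle (other_end i e) t m))"
    using assms(4,5) by (auto simp: flow_con_def slots_def)
  moreover have "fst e \<noteq> snd e" using line_ends[OF assms(1) e(1)] by blast
  ultimately show ?thesis
    using e(2) angle hood by (auto simp: orient_def other_end_def algebra_simps)
qed

lemma central_feasible_imp_id_feasible:
  assumes "id_model D" "central_feasible D w \<theta> p"
  shows "id_feasible D (expand D w \<theta> p) \<theta>"
  using assms(2) unfolding central_feasible_def id_feasible_def
  by (auto simp: sel_def expand_def coords_def slots_def)

lemma corresponds_exists:
  assumes "id_model D" "id_feasible D x z"
  shows "\<exists>w \<theta> p. corresponds D x z w \<theta> p"
proof -
  have "corresponds D x z x z (\<lambda>e (t, m). suscept D e * (z (fst e) (t, m) - z (snd e) (t, m)))"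
    unfolding corresponds_def
  proof (intro conjI ballI impI)
    fix e \<tau> assume e: "e \<in> line_set D" and "\<tau> \<in> slots D"
    moreover obtain t m where "\<tau> = (t, m)" by (cases \<tau>)
    moreover note ends = line_ends[OF assms(1) e]
    ultimately show "case \<tau> of (t, m) \<Rightarrow>
        (case (t, m) of (t, m) \<Rightarrow> suscept D e * (z (fst e) (t, m) - z (snd e) (t, m))) = x (fst e) (Flow e t m) \<and>
        (case (t, m) of (t, m) \<Rightarrow> suscept D e * (z (fst e) (t, m) - z (snd e) (t, m))) = x (snd e) (Flow e t m)"
      using flow_of_angles[OF assms ends(1,4)] flow_of_angles[OF assms ends(2,5)] by simp
  qed simp_all
  then show ?thesis by blast
qed

text \<open>
  Substituting the common angles and flows back recovers the local variables on the nose, so costs and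
  local constraints need not be compared term by term.
\<close>

lemma expand_corresponds:
  assumes "id_model D" "id_feasible D x z" "corresponds D x z w \<theta> p" "i \<in> areas D"
  shows "expand D w \<theta> p i = x i"
proof
  fix c
  show "expand D w \<theta> p i c = x i c"
  proof (cases "c \<in> coords D i")
    case False
    have "x i \<in> area_space D i" using assms(2,4) by (auto simp: id_feasible_def local_set_def)
    with False show ?thesis by (simp add: expand_def area_space_def)
  next
    case True
    have nc: "\<not> is_copy c \<Longrightarrow> w i c = x i c"
      using assms(3,4) True unfolding corresponds_def by blast
    show ?thesis
    proof (cases "is_copy c")
      case False
      then show ?thesis using nc True by (cases c) (auto simp: expand_def)
    next
      case copy: True
      show ?thesis
      proof (cases c)
        case (Angle a t m)
        then have a: "a \<in> hood D i" "(t, m) \<in> slots D" using True by (auto simp: coords_def slots_def)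
        then have "a \<in> areas D" using hood_subset_areas[OF assms(1,4)] by blast
        then have "\<theta> a (t, m) = z a (t, m)" using assms(3) a(2) unfolding corresponds_def by blast
        also have "\<dots> = x i c"
          using assms(2,4) a Angle unfolding id_feasible_def sel_def by fastforce
        finally show ?thesis using True Angle by (simp add: expand_def)
      next
        case (Flow e t m)
        then have e: "e \<in> incident D i" "(t, m) \<in> slots D" using True by (auto simp: coords_def slots_def)
        then have "p e (t, m) = x i (Flow e t m)"
          using assms(3) unfolding corresponds_def incident_def by fastforce
        then show ?thesis using True Flow by (simp add: expand_def)
      qed (use copy in auto)
    qed
  qed
qed

text \<open>
  Expansion maps centralized feasible points to feasible points of the consensus formulation with
  equal cost, and the given point is hit by it.
\<close>

lemma central_optimal_if_id_optimal:
  assumes model: "id_model D" and opt: "id_optimal D x z" and corr: "corresponds D x z w \<theta> p"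
  shows "central_optimal D w \<theta> p"
proof -
  have feas: "id_feasible D x z" using opt by (simp add: id_optimal_def is_arg_min_def)
  note ex = expand_corresponds[OF model feas corr]
  have ref: "ref_area D \<in> areas D" using model by (simp add: id_model_def)
  have theta: "\<theta> a \<tau> = z a \<tau>" if "a \<in> areas D" "\<tau> \<in> slots D" for a \<tau>
    using corr that unfolding corresponds_def by blast
  have "\<theta> (ref_area D) \<tau> = 0" if "\<tau> \<in> slots D" for \<tau>
    using theta[OF ref that] feas that by (simp add: id_feasible_def)
  moreover have "p e \<tau> = suscept D e * (\<theta> (fst e) \<tau> - \<theta> (snd e) \<tau>)"
    if "e \<in> line_set D" "\<tau> \<in> slots D" for e \<tau>
  proof -
    obtain t m where tm: "\<tau> = (t, m)" by (cases \<tau>)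
    note ends = line_ends[OF model that(1)]
    have "p e \<tau> = x (fst e) (Flow e t m)"
      using corr that unfolding corresponds_def tm by fastforce
    also have "\<dots> = suscept D e * (z (fst e) \<tau> - z (snd e) \<tau>)"
      using flow_of_angles[OF model feas ends(1,4)] that(2) unfolding tm by blast
    finally show ?thesis using theta ends(1,2) that(2) by simp
  qed
  moreover have "expand D w \<theta> p i \<in> local_set D i" if "i \<in> areas D" for i
    using ex[OF that] feas that by (simp add: id_feasible_def)
  ultimately have cf: "central_feasible D w \<theta> p" by (simp add: central_feasible_def)
  have cost: "total_cost D (expand D w \<theta> p) = total_cost D x"
    unfolding total_cost_def by (intro sum.cong refl) (simp add: ex)
  have "total_cost D x \<le> total_cost D (expand D w' \<theta>' p')" if "central_feasible D w' \<theta>' p'" for w' \<theta>' p'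
    using opt central_feasible_imp_id_feasible[OF model that]
    by (auto simp: id_optimal_def is_arg_min_def not_less)
  with cf cost show ?thesis by (auto simp: central_optimal_def is_arg_min_def not_less)
qed

theorem theorem17:
  fixes D :: "('g, 'h) id_data"
    and \<rho> J :: real
    and x :: "nat \<Rightarrow> nat \<Rightarrow> 'g coord \<Rightarrow> real"
    and z :: "nat \<Rightarrow> nat \<Rightarrow> block"
    and y :: "nat \<Rightarrow> nat \<Rightarrow> nat \<Rightarrow> block"
  assumes "id_model D"
    and "standing_conditions D"
    and "\<rho> > 0"
    and "id_value D = ereal J"
    and "\<exists>xs zs ys. saddle_point D xs zs ys"
    and "admm_iterates D \<rho> x z y"
  shows "stacked_tendsto D (\<lambda>k. primal_residual (x k) (z k)) (\<lambda>i a \<tau>. 0) \<and>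
    (\<lambda>k. total_cost D (x k)) \<longlonglongrightarrow> J \<and>
    (\<exists>ys. dual_solution D ys \<and> stacked_tendsto D y ys) \<and>
    (\<forall>xb zb. accumulation_point D x z xb zb \<longrightarrow>
       id_optimal D xb zb \<and>
       (\<exists>w \<theta> p. corresponds D xb zb w \<theta> p) \<and>
       (\<forall>w \<theta> p. corresponds D xb zb w \<theta> p \<longrightarrow> central_optimal D w \<theta> p))"
proof -
  note model = assms(1) and admm = assms(6)
  obtain xs zs ys where saddle: "saddle_point D xs zs ys" using assms(5) by blast
  have feas: "id_feasible D xs zs" by (rule saddle_point_feasible[OF model saddle])
  have J: "total_cost D xs = J" using saddle_point_value[OF model saddle] assms(4) by simp
  note cons = admm_iterates_imp_consensus_admm[OF model assms(2,3) admm feas, unfolded J]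
  interpret consensus_admm "copy_index D" "consensus D" "attainable D" \<rho> J
    "\<lambda>k. total_cost D (x (Suc k))" "\<lambda>k. copies (x (Suc k))" "\<lambda>k. spread (z (Suc k))"
    "\<lambda>k. stack (y (Suc k))" "copies xs"
    by (rule cons)
  note mult_iff = multiplier_iff_lagrangian[OF model cons]
  have ys: "multiplier (stack ys)"
    unfolding mult_iff using saddle_point_le[OF model saddle] J by auto
  have res: "stacked_tendsto D (\<lambda>k. primal_residual (x k) (z k)) (\<lambda>i a \<tau>. 0)"
    unfolding stacked_tendsto_def
  proof (intro ballI)
    fix i a \<tau> assume "i \<in> areas D" "a \<in> hood D i" "\<tau> \<in> slots D"
    then have "(i, a, \<tau>) \<in> copy_index D" by (simp add: copy_index_def)
    from residuals_null(1)[OF ys this, unfolded residual_def]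
    have "(\<lambda>k. primal_residual (x (Suc (Suc k))) (z (Suc (Suc k))) i a \<tau>) \<longlonglongrightarrow> 0"
      by (simp add: copies_def spread_def primal_residual_def)
    then have "(\<lambda>k. primal_residual (x (Suc k)) (z (Suc k)) i a \<tau>) \<longlonglongrightarrow> 0"
      by (rule LIMSEQ_imp_Suc)
    then show "(\<lambda>k. primal_residual (x k) (z k) i a \<tau>) \<longlonglongrightarrow> 0"
      by (rule LIMSEQ_imp_Suc)
  qed
  have cost: "(\<lambda>k. total_cost D (x k)) \<longlonglongrightarrow> J"
    using cost_tendsto[OF ys] by (rule LIMSEQ_imp_Suc)
  have dual: "\<exists>ys. dual_solution D ys \<and> stacked_tendsto D y ys"
  proof -
    obtain yb where yb: "multiplier yb" "\<forall>\<kappa>\<in>copy_index D. (\<lambda>k. stack (y (Suc k)) \<kappa>) \<longlonglongrightarrow> yb \<kappa>"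
      using Y_tendsto_multiplier[OF ys] by blast
    let ?yb = "\<lambda>i a \<tau>. yb (i, a, \<tau>)"
    have st: "stack ?yb = yb" by (auto simp: stack_def)
    have "dual_solution D ?yb"
      using yb(1) mult_iff[of ?yb] unfolding st by (intro dual_solutionI[OF feas]) (auto simp: J)
    moreover have "stacked_tendsto D y ?yb"
      unfolding stacked_tendsto_def
    proof (intro ballI)
      fix i a \<tau> assume "i \<in> areas D" "a \<in> hood D i" "\<tau> \<in> slots D"
      then have "(i, a, \<tau>) \<in> copy_index D" by (simp add: copy_index_def)
      with yb(2) have "(\<lambda>k. stack (y (Suc k)) (i, a, \<tau>)) \<longlonglongrightarrow> yb (i, a, \<tau>)" by blast
      then have "(\<lambda>k. y (Suc k) i a \<tau>) \<longlonglongrightarrow> yb (i, a, \<tau>)" by (simp add: stack_def)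
      then show "(\<lambda>k. y k i a \<tau>) \<longlonglongrightarrow> yb (i, a, \<tau>)" by (rule LIMSEQ_imp_Suc)
    qed
    ultimately show ?thesis by blast
  qed
  have "id_optimal D xb zb" if "accumulation_point D x z xb zb" for xb zb
    using accumulation_point_optimal[OF model assms(2,4) _ _ res cost that] admm
    unfolding admm_iterates_def is_arg_min_def by blast
  moreover have "\<exists>w \<theta> p. corresponds D xb zb w \<theta> p" if "id_optimal D xb zb" for xb zb
    using corresponds_exists[OF model] that by (simp add: id_optimal_def is_arg_min_def)
  ultimately show ?thesis
    using res cost dual central_optimal_if_id_optimal[OF model] by blast
qed

end
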